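(* Let $p\ge2$, $s\in\{1,\dots,p\}$, $\varepsilon>0$, and set $c_0=1+1/\varepsilon$. Let $\hat{\boldsymbol\beta}$ be the Lasso estimator with tuning parameter $$\lambda=(1+\varepsilon)\sigma\sqrt{2\log(p)/n}.$$ Then for any $\delta\in(0,1)$, $$\|\mathbb X\hat{\boldsymbol\beta}-\mathbf f\|_n^2\le\inf_{\boldsymbol\beta\in\mathbb R^p:|\boldsymbol\beta|_0\le s}\|\mathbb X\boldsymbol\beta-\mathbf f\|_n^2+\frac{\sigma^2}n\left(\frac{(1+\varepsilon)\sqrt{2s\log p}}{\kappa(s,c_0)}+\sqrt s+\sqrt{2\log(1/\delta)}+2.8\right)^2$$ holds with probability at least $1-\delta$.
   Context: Let $n\ge1$, $\sigma>0$, and let $\mathbb X\in\mathbb R^{n\times p}$ be a deterministic matrix with $\|\mathbb X\boldsymbol e_j\|_n\le1$ for all $j=1,\dots,p$, where $(\boldsymbol e_j)$ is the canonical basis of $\mathbb R^p$ and $\|\boldsymbol u\|_n^2=\frac1n\sum_{i=1}^nu_i^2$. Let $\mathbf f\in\mathbb R^n$ be deterministic, $\boldsymbol\xi\sim\mathcal N(\mathbf 0,\sigma^2I_{n\times n})$, $\mathbf y=\mathbf f+\boldsymbol\xi$. $|\cdot|_q$ is the $\ell_q$ norm on $\mathbb R^p$ and $|\boldsymbol\beta|_0$ is the number of nonzero components. Lasso estimator with tuning parameter $\lambda>0$: any $\hat{\boldsymbol\beta}\in\arg\min_{\boldsymbol\beta\in\mathbb R^p}\big(\|\mathbb X\boldsymbol\beta-\mathbf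 y\|_n^2+2\lambda|\boldsymbol\beta|_1\big)$. Restricted eigenvalue constant: $$\kappa(s,c_0)=\inf_{\boldsymbol\delta\in\mathcal C_{RE}(s,c_0),\boldsymbol\delta\ne\mathbf 0}\frac{\|\mathbb X\boldsymbol\delta\|_n}{|\boldsymbol\delta|_2},\qquad\mathcal C_{RE}(s,c_0)=\Big\{\boldsymbol\delta\in\mathbb R^p:|\boldsymbol\delta|_1\le(1+c_0)\sum_{j=1}^s\delta_j^\sharp\Big\},$$ with $\delta_1^\sharp\ge\dots\ge\delta_p^\sharp$ a non-increasing rearrangement of $|\delta_1|,\dots,|\delta_p|$. If $\kappa(s,c_0)=0$ the right-hand side of the bound is read as $+\infty$. *)

theory Defs
  imports "HOL-Probability.Probability"
begin

definition emp_norm :: "real ^ 'n \<Rightarrow> real" where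
  "emp_norm u = sqrt ((1 / real CARD('n)) * (\<Sum>i\<in>UNIV. (u $ i)\<^sup>2))"

definition l1_norm :: "real ^ 'p \<Rightarrow> real" where
  "l1_norm b = (\<Sum>j\<in>UNIV. \<bar>b $ j\<bar>)"

definition l0_norm :: "real ^ 'p \<Rightarrow> nat" where
  "l0_norm b = card {j. b $ j \<noteq> 0}"

definition is_lasso :: "real ^ 'p ^ 'n \<Rightarrow> real ^ 'n \<Rightarrow> real \<Rightarrow> real ^ 'p \<Rightarrow> bool" where
  "is_lasso X y lam b \<longleftrightarrow>
     is_arg_min (\<lambda>b'. (emp_norm (X *v b' - y))\<^sup>2 + 2 * lam * l1_norm b') (\<lambda>_. True) b"

text \<open>The absolute values of the components, with multiplicity, in non-increasing order.
  List positions start at 0, so the largest absolute value is at position 0.\<close>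

definition abs_decreasing :: "real ^ 'p \<Rightarrow> real list" where
  "abs_decreasing d =
     rev (sorted_list_of_multiset (image_mset (\<lambda>j. \<bar>d $ j\<bar>) (mset_set UNIV)))"

definition RE_cone :: "nat \<Rightarrow> real \<Rightarrow> (real ^ 'p) set" where
  "RE_cone s c0 = {d. l1_norm d \<le> (1 + c0) * (\<Sum>j=1..s. abs_decreasing d ! (j - 1))}"

text \<open>The infimum is taken in the reals. It is meaningful for \<open>1 \<le> s \<le> p\<close> and \<open>c0 \<ge> 0\<close>, when
  the cone contains the canonical basis vectors.\<close>

definition RE_const :: "real ^ 'p ^ 'n \<Rightarrow> nat \<Rightarrow> real \<Rightarrow> real" where
  "RE_const X s c0 = (INF d\<in>{d \<in> RE_cone s c0. d \<noteq> 0}. emp_norm (X *v d) / norm d)"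

text \<open>Lebesgue density of the centred Gaussian law with covariance \<open>\<sigma>\<^sup>2\<close> times the identity:
  the coordinates are independent with variance \<open>\<sigma>\<^sup>2\<close>. The second argument of
  \<^const>\<open>normal_density\<close> is the standard deviation.\<close>

definition iso_normal_density :: "real \<Rightarrow> real ^ 'n \<Rightarrow> real" where
  "iso_normal_density \<sigma> x = (\<Prod>i\<in>UNIV. normal_density 0 \<sigma> (x $ i))"

end

theory Submission
  imports Defs
begin

text \<open>
  Write \<open>|.|\<close> for the Euclidean norm on \<open>real ^ 'n\<close>, \<open>n\<close> for its dimension and \<open>p\<close> for the number of
  columns. The infimum over sparse vectors is attained at some \<open>\<beta>\<close>
  (\<open>sparse_least_squares_attained\<close>); let \<open>S\<close> be its support and \<open>u = \<beta>hat - \<beta>\<close>. Optimality of the Lasso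
  (\<open>lasso_basic_inequality\<close>) bounds \<open>n\<close> times the excess loss over \<open>\<beta>\<close> by
  \<open>2 (\<xi> \<bullet> X u + n lam (l1_norm \<beta> - l1_norm (\<beta> + u))) - |X u|\<^sup>2\<close>. With
  \<open>G z = sup {(z \<bullet> X u + n lam (l1_norm \<beta> - l1_norm (\<beta> + u))) / |X u|}\<close> this is at most
  \<open>2 G(\<xi>) |X u| - |X u|\<^sup>2\<close>, hence at most \<open>r\<^sup>2\<close> as soon as \<open>G(\<xi>) \<le> r\<close> with \<open>r \<ge> 0\<close>. Everything therefore
  rests on an upper deviation bound for \<open>G(\<xi>)\<close>.

  The function \<open>G\<close> is a supremum of affine functions with slopes of norm one, so it is 1-Lipschitz, and
  Gaussian concentration gives \<open>G(\<xi>) \<le> E G(\<xi>) + \<sigma> sqrt (2 ln (1 / \<delta>))\<close> with probability at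
  least \<open>1 - \<delta>\<close> (applied to a truncation of \<open>G\<close>). The confidence level enters only
  here, which is why the tuning parameter is free of \<open>\<delta>\<close>.

  To bound the mean, let \<open>P\<close> be the orthogonal projection onto the span of the columns in \<open>S\<close>. By the Lipschitz
  property \<open>G(\<xi>) \<le> G(\<xi> - P \<xi>) + |P \<xi>|\<close>, and \<open>|P \<xi>|\<close> has mean at most \<open>\<sigma> sqrt s\<close>. The residual \<open>\<xi> - P \<xi>\<close> is
  orthogonal to the columns in \<open>S\<close>, so it acts only on the coordinates of \<open>u\<close> outside \<open>S\<close>. When its inner
  products with all columns are at most \<open>\<sigma> sqrt (2 n ln p)\<close>, it consumes at most the fraction \<open>1 / (1 + \<epsilon>)\<close> of
  the penalty there; what remains is nonpositive unless \<open>u\<close> lies in the cone with constant \<open>1 + 1 / \<epsilon>\<close>, where the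
  restricted eigenvalue applies. This yields \<open>G(\<xi> - P \<xi>) \<le> K\<close> with
  \<open>K = \<sigma> (1 + \<epsilon>) sqrt (2 s ln p) / \<kappa>\<close>. By the Gaussian tail bound this happens with probability at
  least 0.29 (\<open>maximal_inequality\<close>). A fixed probability of this size suffices: the lower tail of the Lipschitz
  function \<open>G(z - P z)\<close> at distance \<open>2.8 \<sigma>\<close> is at most \<open>exp (- 2.8\<^sup>2 / 2)\<close>, which is below 0.29, so the mean of
  \<open>G(\<xi> - P \<xi>)\<close> cannot exceed \<open>K + 2.8 \<sigma>\<close> (\<open>lipschitz_deviation_modulo_projection\<close>).

  Concentration with the sharp constant comes from the Prekopa-Leindler inequality. Its one-dimensional form
  follows from the Brunn-Minkowski inequality for superlevel sets. Applied to Gaussian densities with the constant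
  function 1 in one slot it becomes an inequality between two functions that passes to products by induction on
  the number of coordinates (\<open>prekopa_leindler_normal_product\<close>). For an \<open>L\<close>-Lipschitz \<open>F\<close> it says
  \<open>(E exp F) powr t \<le> exp (t (1 - t) L\<^sup>2 \<sigma>\<^sup>2 / 2) E exp (t F)\<close>, and letting \<open>t\<close> tend to 0 gives
  \<open>E exp F \<le> exp (E F + L\<^sup>2 \<sigma>\<^sup>2 / 2)\<close> (\<open>lipschitz_mgf\<close>).

  Since \<open>\<beta>hat\<close> is an arbitrary choice of minimizers, measurability of the event needs an argument: the fit
  \<open>X \<beta>hat\<close> is a 1-Lipschitz function of the data (\<open>lasso_fit_nonexpansive\<close>).
\<close>

section \<open>The Prekopa-Leindler inequality on the line\<close>

text \<open>Used to exhaust a set by its initial segments that end at a point of the set; the endpoints have to belong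
to the set because only sums of two members are under control in the next inequality.\<close>

lemma cofinal_incseq_real:
  fixes A :: "real set"
  assumes "A \<noteq> {}"
  obtains a :: "nat \<Rightarrow> real" where "incseq a" "\<And>k. a k \<in> A" "A \<subseteq> (\<Union>k. {..a k})"
proof -
  have "\<exists>a::nat \<Rightarrow> real. (\<forall>k. a k \<in> A) \<and> A \<subseteq> (\<Union>k. {..a k})"
  proof (cases "bdd_above A")
    case False
    have "\<exists>x\<in>A. real k \<le> x" for k
      using False by (meson bdd_above.I nle_le)
    then obtain a where a: "\<And>k. a k \<in> A" "\<And>k. real k \<le> a k"
      by metis
    have "x \<in> (\<Union>k. {..a k})" for x
      using a(2) real_arch_simple[of x] order_trans by (meson UN_iff UNIV_I atMost_iff)
    then show ?thesis
      using a by blast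
  next
    case True
    show ?thesis
    proof (cases "Sup A \<in> A")
      case Sup: True
      show ?thesis
        by (rule exI[of _ "\<lambda>_. Sup A"]) (use True Sup in \<open>auto intro: cSup_upper\<close>)
    next
      case Sup: False
      have "\<exists>x\<in>A. Sup A - 1 / real (Suc k) < x" for k
        using less_cSup_iff[OF assms True, of "Sup A - 1 / real (Suc k)"] by simp
      then obtain a where a: "\<And>k. a k \<in> A" "\<And>k. Sup A - 1 / real (Suc k) < a k"
        by metis
      have "x \<in> (\<Union>k. {..a k})" if "x \<in> A" for x
      proof -
        have "x < Sup A"
          using cSup_upper[OF that True] Sup that by (metis order_le_less)
        then obtain k where "1 / real (Suc k) < Sup A - x"
          using nat_approx_posE[of "Sup A - x"] by auto
        then have "x \<le> a k"
          using a(2)[of k] by linarith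
        then show ?thesis by auto
      qed
      then show ?thesis
        using a by blast
    qed
  qed
  then obtain a :: "nat \<Rightarrow> real" where a: "\<And>k. a k \<in> A" "A \<subseteq> (\<Union>k. {..a k})"
    by blast
  \<comment> \<open>Running maxima make the sequence monotone without leaving the set.\<close>
  define b where "b k = Max (a ` {..k})" for k
  show ?thesis
  proof
    show "incseq b"
      unfolding b_def incseq_def by (intro allI impI Max_mono image_mono) auto
    show "b k \<in> A" for k
    proof -
      have "b k \<in> a ` {..k}"
        unfolding b_def by (rule Max_in) auto
      then obtain j where "b k = a j"
        by auto
      then show ?thesis
        using a(1)[of j] by simp
    qed
    have "a k \<le> b k" for k
      unfolding b_def by simp
    then have "{..a k} \<subseteq> {..b k}" for k
      by simp
    then have "(\<Union>k. {..a k}) \<subseteq> (\<Union>k. {..b k})"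
      by (intro UN_mono) auto
    with a(2) show "A \<subseteq> (\<Union>k. {..b k})"
      by (rule order_trans)
  qed
qed

lemma emeasure_lborel_affine_vimage:
  fixes A :: "real set"
  assumes [measurable]: "A \<in> sets borel" and "c > 0"
  shows "emeasure lborel {x. (x - d) / c \<in> A} = ennreal c * emeasure lborel A"
proof -
  have "emeasure lborel {x. (x - d) / c \<in> A} = (\<integral>\<^sup>+x. indicator {x. (x - d) / c \<in> A} x \<partial>lborel)"
    by simp
  also have "\<dots> = \<bar>c\<bar> * (\<integral>\<^sup>+x. indicator {x. (x - d) / c \<in> A} (d + c * x) \<partial>lborel)"
    using assms by (intro nn_integral_real_affine) auto
  also have "(\<integral>\<^sup>+x. indicator {x. (x - d) / c \<in> A} (d + c * x) \<partial>lborel) = (\<integral>\<^sup>+x. indicator A x \<partial>lborel)"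
    using assms by (intro nn_integral_cong) (auto simp: indicator_def)
  finally show ?thesis using assms by simp
qed

text \<open>For members \<open>a\<close> and \<open>b\<close>, the part of \<open>t A\<close> to the left of \<open>t a\<close> shifted by \<open>s b\<close> and the part of \<open>s B\<close> to the
right of \<open>s b\<close> shifted by \<open>t a\<close> both lie in \<open>H\<close> and meet in one point only. Letting \<open>a\<close> run to the upper end of \<open>A\<close>
and \<open>b\<close> to the lower end of \<open>B\<close> exhausts both sets.\<close>

lemma brunn_minkowski_real:
  fixes A B H :: "real set"
  assumes [measurable]: "A \<in> sets borel" "B \<in> sets borel" "H \<in> sets borel"
    and "A \<noteq> {}" "B \<noteq> {}" and t: "t > 0" and s: "s > 0"
    and H: "\<And>a b. a \<in> A \<Longrightarrow> b \<in> B \<Longrightarrow> t * a + s * b \<in> H"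
  shows "ennreal t * emeasure lborel A + ennreal s * emeasure lborel B \<le> emeasure lborel H"
proof -
  have step: "ennreal t * emeasure lborel (A \<inter> {..a}) + ennreal s * emeasure lborel (B \<inter> {b..})
      \<le> emeasure lborel H" if a: "a \<in> A" and b: "b \<in> B" for a b
  proof -
    define A' where "A' = {x. (x - s * b) / t \<in> A \<inter> {..a}}"
    define B' where "B' = {x. (x - t * a) / s \<in> B \<inter> {b..}}"
    define z where "z = t * a + s * b"
    have [measurable]: "A' \<in> sets borel" "B' \<in> sets borel"
      unfolding A'_def B'_def by measurable
    have "A' \<subseteq> H"
    proof
      fix x assume "x \<in> A'"
      then have "t * ((x - s * b) / t) + s * b \<in> H"
        unfolding A'_def using b by (intro H) auto
      then show "x \<in> H" using t by simp
    qed
    moreover have "B' \<subseteq> H"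
    proof
      fix x assume "x \<in> B'"
      then have "t * a + s * ((x - t * a) / s) \<in> H"
        unfolding B'_def using a by (intro H) auto
      then show "x \<in> H" using s by simp
    qed
    moreover have "A' \<inter> (B' - {z}) = {}"
      using t s unfolding A'_def B'_def z_def by (auto simp: field_simps)
    ultimately have "emeasure lborel A' + emeasure lborel (B' - {z}) \<le> emeasure lborel H"
      by (subst plus_emeasure) (auto intro!: emeasure_mono)
    moreover have "emeasure lborel (B' - {z}) = emeasure lborel B'"
      by (intro emeasure_Diff_null_set) (auto intro: null_setsI)
    moreover have "emeasure lborel A' = ennreal t * emeasure lborel (A \<inter> {..a})"
      unfolding A'_def by (rule emeasure_lborel_affine_vimage) (use t in auto)
    moreover have "emeasure lborel B' = ennreal s * emeasure lborel (B \<inter> {b..})"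
      unfolding B'_def by (rule emeasure_lborel_affine_vimage) (use s in auto)
    ultimately show ?thesis by simp
  qed
  obtain a where a: "incseq a" "\<And>k. a k \<in> A" "A \<subseteq> (\<Union>k. {..a k})"
    using cofinal_incseq_real[OF \<open>A \<noteq> {}\<close>] by blast
  obtain b where b: "incseq b" "\<And>k. b k \<in> uminus ` B" "uminus ` B \<subseteq> (\<Union>k. {..b k})"
    using cofinal_incseq_real[of "uminus ` B"] \<open>B \<noteq> {}\<close> by blast
  have "(\<Union>k. A \<inter> {..a k}) = A" using a(3) by auto
  moreover have "(\<lambda>k. emeasure lborel (A \<inter> {..a k})) \<longlonglongrightarrow> emeasure lborel (\<Union>k. A \<inter> {..a k})"
    using a(1) by (intro Lim_emeasure_incseq) (auto simp: incseq_def intro: order_trans)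
  ultimately have limA: "(\<lambda>k. emeasure lborel (A \<inter> {..a k})) \<longlonglongrightarrow> emeasure lborel A" by simp
  have "(\<Union>k. B \<inter> {- b k..}) = B"
  proof -
    have "\<exists>k. - b k \<le> x" if "x \<in> B" for x
    proof -
      have "- x \<in> (\<Union>k. {..b k})" using that b(3) by blast
      then show ?thesis by (auto simp: minus_le_iff)
    qed
    then show ?thesis by auto
  qed
  moreover have "(\<lambda>k. emeasure lborel (B \<inter> {- b k..})) \<longlonglongrightarrow> emeasure lborel (\<Union>k. B \<inter> {- b k..})"
    using b(1) by (intro Lim_emeasure_incseq) (auto simp: incseq_def intro: order_trans[rotated])
  ultimately have limB: "(\<lambda>k. emeasure lborel (B \<inter> {- b k..})) \<longlonglongrightarrow> emeasure lborel B" by simp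
  have "(\<lambda>k. ennreal t * emeasure lborel (A \<inter> {..a k}) + ennreal s * emeasure lborel (B \<inter> {- b k..}))
      \<longlonglongrightarrow> ennreal t * emeasure lborel A + ennreal s * emeasure lborel B"
    by (intro tendsto_add ennreal_tendsto_cmult limA limB) auto
  moreover have "- b k \<in> B" for k
    using b(2)[of k] by auto
  ultimately show ?thesis
    using step a(2) by (intro LIMSEQ_le_const2) auto
qed

text \<open>Truncation at \<open>C\<close> turns the layer-cake formula into an average over the levels \<open>C c\<close> with \<open>c\<close> in the unit
interval. In this form three functions with different suprema can be compared level by level.\<close>

lemma nn_integral_min_layer_cake:
  fixes k :: "real \<Rightarrow> real"
  assumes [measurable]: "k \<in> borel_measurable borel" and k: "\<And>x. 0 \<le> k x" and C: "C > 0"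
  shows "(\<integral>\<^sup>+x. ennreal (min (k x) C) \<partial>lborel) =
    ennreal C * (\<integral>\<^sup>+c. indicator {0<..<1} c * emeasure lborel {x. C * c < k x} \<partial>lborel)"
proof -
  have "(\<integral>\<^sup>+c. indicator {0<..<1} c * emeasure lborel {x. C * c < k x} \<partial>lborel) =
      (\<integral>\<^sup>+c. (\<integral>\<^sup>+x. indicator {0<..<1} c * indicator {x. C * c < k x} x \<partial>lborel) \<partial>lborel)"
    by (intro nn_integral_cong) (simp add: nn_integral_cmult)
  also have "\<dots> = (\<integral>\<^sup>+x. (\<integral>\<^sup>+c. indicator {0<..<1} c * indicator {x. C * c < k x} x \<partial>lborel) \<partial>lborel)"
    by (rule lborel_pair.Fubini') (simp add: indicator_def)
  also have "\<dots> = (\<integral>\<^sup>+x. ennreal (min (k x) C / C) \<partial>lborel)"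
  proof (intro nn_integral_cong)
    fix x
    have "(\<integral>\<^sup>+c. indicator {0<..<1} c * indicator {x. C * c < k x} x \<partial>lborel) =
        (\<integral>\<^sup>+c. indicator {0<..<min (k x) C / C} c \<partial>lborel)"
    proof (intro nn_integral_cong)
      fix c
      have "C * c < k x \<longleftrightarrow> c < k x / C" and min: "min (k x) C / C = min (k x / C) 1"
        using C by (simp_all add: min_def field_simps)
      then show "indicator {0<..<1} c * indicator {x. C * c < k x} x = (indicator {0<..<min (k x) C / C} c :: ennreal)"
        unfolding min
        unfolding indicator_def by (cases "0 < c"; cases "c < 1"; cases "c < k x / C") simp_all
    qed
    also have "\<dots> = ennreal (min (k x) C / C)"
      using C k by simp
    finally show "(\<integral>\<^sup>+c. indicator {0<..<1} c * indicator {x. C * c < k x} x \<partial>lborel)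
      = ennreal (min (k x) C / C)" .
  qed
  also have "ennreal C * \<dots> = (\<integral>\<^sup>+x. ennreal C * ennreal (min (k x) C / C) \<partial>lborel)"
    by (rule nn_integral_cmult[symmetric]) simp
  also have "\<dots> = (\<integral>\<^sup>+x. ennreal (min (k x) C) \<partial>lborel)"
    using C k by (intro nn_integral_cong) (simp flip: ennreal_mult'')
  finally show ?thesis ..
qed

lemma weighted_am_gm:
  fixes x y t :: real
  assumes "0 \<le> x" "0 \<le> y" "0 < t" "t < 1"
  shows "x powr t * y powr (1 - t) \<le> t * x + (1 - t) * y"
  using Youngs_inequality_0[of t "1 - t" x y] assms by (cases "x = 0 \<or> y = 0") auto

text \<open>Let \<open>a\<close> and \<open>b\<close> be the suprema of \<open>f\<close> and \<open>g\<close>, and \<open>C = a powr t * b powr (1 - t)\<close>. For \<open>0 < c < 1\<close> the sets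
\<open>{f > a c}\<close> and \<open>{g > b c}\<close> are nonempty and their weighted sum lies in \<open>{h > C c}\<close>, so the Brunn-Minkowski
inequality compares the measures. Integration over \<open>c\<close> bounds the integral of \<open>h\<close> from below by an arithmetic
mean of the two normalized integrals, and the weighted inequality of the means finishes the proof. Normalizing
both suprema is what makes the two superlevel sets nonempty for the same \<open>c\<close>.\<close>

theorem prekopa_leindler_real:
  fixes f g h :: "real \<Rightarrow> real"
  assumes f: "integrable lborel f" "\<And>x. 0 \<le> f x" "bdd_above (range f)"
    and g: "integrable lborel g" "\<And>x. 0 \<le> g x" "bdd_above (range g)"
    and h: "integrable lborel h" "\<And>x. 0 \<le> h x"
    and t: "0 < t" "t < 1"
    and le: "\<And>x y. f x powr t * g y powr (1 - t) \<le> h (t * x + (1 - t) * y)"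
  shows "(\<integral>x. f x \<partial>lborel) powr t * (\<integral>x. g x \<partial>lborel) powr (1 - t) \<le> (\<integral>x. h x \<partial>lborel)"
proof -
  define a b where "a = Sup (range f)" and "b = Sup (range g)"
  have fa: "f x \<le> a" and gb: "g x \<le> b" for x
    unfolding a_def b_def using f(3) g(3) by (auto intro: cSup_upper)
  show ?thesis
  proof (cases "a \<le> 0 \<or> b \<le> 0")
    case True
    then have "(\<forall>x. f x = 0) \<or> (\<forall>x. g x = 0)"
      using fa gb f(2) g(2) by (meson order_antisym order_trans)
    then show ?thesis
      using h(2) by auto
  next
    case False
    then have a: "a > 0" and b: "b > 0" by auto
    have [measurable]: "f \<in> borel_measurable borel" "g \<in> borel_measurable borel"
      "h \<in> borel_measurable borel"
      using f(1) g(1) h(1) by (auto dest: borel_measurable_integrable)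
    define C where "C = a powr t * b powr (1 - t)"
    have C: "C > 0" using a b by (simp add: C_def)
    have bm: "ennreal t * emeasure lborel {x. a * c < f x} + ennreal (1 - t) * emeasure lborel {x. b * c < g x}
        \<le> emeasure lborel {x. C * c < h x}" if c: "0 < c" "c < 1" for c
    proof (rule brunn_minkowski_real)
      show "{x. a * c < f x} \<noteq> {}"
        using less_cSup_iff[OF _ f(3), of "a * c"] a c unfolding a_def[symmetric] by auto
      show "{x. b * c < g x} \<noteq> {}"
        using less_cSup_iff[OF _ g(3), of "b * c"] b c unfolding b_def[symmetric] by auto
      fix x y assume xy: "x \<in> {x. a * c < f x}" "y \<in> {x. b * c < g x}"
      have "C * c = (a * c) powr t * (b * c) powr (1 - t)"
        using a b c by (simp add: C_def powr_mult) (simp add: powr_diff)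
      also have "\<dots> < f x powr t * g y powr (1 - t)"
      proof (rule mult_strict_mono)
        show "(a * c) powr t < f x powr t" "(b * c) powr (1 - t) < g y powr (1 - t)"
          using xy a b c t by (auto intro!: powr_less_mono2 simp: less_imp_le)
        show "0 < f x powr t"
          using xy mult_pos_pos[OF a c(1)] by simp
      qed simp
      also have "\<dots> \<le> h (t * x + (1 - t) * y)" by (rule le)
      finally show "t * x + (1 - t) * y \<in> {x. C * c < h x}" by simp
    qed (use t in auto)
    let ?J = "\<lambda>k C. \<integral>\<^sup>+c. indicator {0<..<1} c * emeasure lborel {x. C * c < k x} \<partial>lborel"
    have J: "ennreal C * ?J k C = (\<integral>\<^sup>+x. ennreal (min (k x) C) \<partial>lborel)"
      if "k \<in> borel_measurable borel" "\<And>x. 0 \<le> k x" "C > 0" for C and k :: "real \<Rightarrow> real"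
      using nn_integral_min_layer_cake[OF that] by simp
    have Jm: "(\<lambda>c. indicator {0<..<1} c * emeasure lborel {x. C * c < k x}) \<in> borel_measurable borel"
      if [measurable]: "k \<in> borel_measurable borel" for C and k :: "real \<Rightarrow> real"
    proof -
      have "(\<lambda>c. emeasure lborel {x. C * c < k x}) = (\<lambda>c. \<integral>\<^sup>+x. indicator {z. C * fst z < k (snd z)} (c, x) \<partial>lborel)"
        by (auto simp: fun_eq_iff simp flip: nn_integral_indicator intro!: nn_integral_cong split: split_indicator)
      also have "\<dots> \<in> borel_measurable borel"
        by measurable
      finally show ?thesis by measurable
    qed
    have Jf: "ennreal a * ?J f a = ennreal (\<integral>x. f x \<partial>lborel)"
      using f fa a by (subst J) (auto simp: min_absorb1 nn_integral_eq_integral)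
    have Jg: "ennreal b * ?J g b = ennreal (\<integral>x. g x \<partial>lborel)"
      using g gb b by (subst J) (auto simp: min_absorb1 nn_integral_eq_integral)
    have Jh: "ennreal C * ?J h C \<le> ennreal (\<integral>x. h x \<partial>lborel)"
      using h C by (subst J) (auto simp flip: nn_integral_eq_integral intro!: nn_integral_mono)
    have int0: "0 \<le> (\<integral>x. f x \<partial>lborel)" "0 \<le> (\<integral>x. g x \<partial>lborel)" using f g by auto
    have Jf': "?J f a = ennreal ((\<integral>x. f x \<partial>lborel) / a)"
    proof -
      have "?J f a = ennreal (1 / a) * (ennreal a * ?J f a)"
        using a by (simp add: mult.assoc[symmetric] flip: ennreal_mult'')
      then show ?thesis using Jf a int0 by (simp flip: ennreal_mult'')
    qed
    have Jg': "?J g b = ennreal ((\<integral>x. g x \<partial>lborel) / b)"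
    proof -
      have "?J g b = ennreal (1 / b) * (ennreal b * ?J g b)"
        using b by (simp add: mult.assoc[symmetric] flip: ennreal_mult'')
      then show ?thesis using Jg b int0 by (simp flip: ennreal_mult'')
    qed
    have "ennreal t * ?J f a + ennreal (1 - t) * ?J g b =
       (\<integral>\<^sup>+c. ennreal t * (indicator {0<..<1} c * emeasure lborel {x. a * c < f x}) +
          ennreal (1 - t) * (indicator {0<..<1} c * emeasure lborel {x. b * c < g x}) \<partial>lborel)"
      using Jm[of f a] Jm[of g b] by (simp add: nn_integral_add nn_integral_cmult)
    also have "\<dots> \<le> ?J h C"
      using bm by (intro nn_integral_mono) (auto simp: indicator_def)
    finally have "ennreal C * (ennreal t * ?J f a + ennreal (1 - t) * ?J g b) \<le> ennreal C * ?J h C"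
      by (rule mult_left_mono) simp
    also note Jh
    also have "ennreal C * (ennreal t * ?J f a + ennreal (1 - t) * ?J g b) =
        ennreal (C * (t * ((\<integral>x. f x \<partial>lborel) / a) + (1 - t) * ((\<integral>x. g x \<partial>lborel) / b)))"
      unfolding Jf' Jg' using a b C t int0
      by (simp flip: ennreal_mult ennreal_plus)
    finally have "ennreal (C * (t * ((\<integral>x. f x \<partial>lborel) / a) + (1 - t) * ((\<integral>x. g x \<partial>lborel) / b)))
        \<le> ennreal (\<integral>x. h x \<partial>lborel)" .
    then have "C * (t * ((\<integral>x. f x \<partial>lborel) / a) + (1 - t) * ((\<integral>x. g x \<partial>lborel) / b)) \<le> (\<integral>x. h x \<partial>lborel)"
      using h(2) by (simp add: ennreal_le_iff)
    moreover have "C * (((\<integral>x. f x \<partial>lborel) / a) powr t * ((\<integral>x. g x \<partial>lborel) / b) powr (1 - t)) \<le>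
        C * (t * ((\<integral>x. f x \<partial>lborel) / a) + (1 - t) * ((\<integral>x. g x \<partial>lborel) / b))"
      using C a b t int0 by (intro mult_left_mono weighted_am_gm) auto
    moreover have "C * (((\<integral>x. f x \<partial>lborel) / a) powr t * ((\<integral>x. g x \<partial>lborel) / b) powr (1 - t)) =
        (\<integral>x. f x \<partial>lborel) powr t * (\<integral>x. g x \<partial>lborel) powr (1 - t)"
      using a b int0 by (simp add: C_def powr_divide)
    ultimately show ?thesis by linarith
  qed
qed

section \<open>A Prekopa-Leindler inequality for products of normal laws\<close>

abbreviation normal_measure :: "real \<Rightarrow> real measure" where
  "normal_measure \<sigma> \<equiv> density lborel (\<lambda>x. ennreal (normal_density 0 \<sigma> x))"

text \<open>Strong log-concavity of the normal density, as an identity.\<close>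

lemma normal_density_convex_combination:
  assumes "\<sigma> > 0"
  shows "normal_density 0 \<sigma> x powr t * normal_density 0 \<sigma> y powr (1 - t) =
    exp (- (t * (1 - t) * (x - y)\<^sup>2 / (2 * \<sigma>\<^sup>2))) * normal_density 0 \<sigma> (t * x + (1 - t) * y)"
proof -
  define K where "K = 1 / sqrt (2 * pi * \<sigma>\<^sup>2)"
  have K: "K > 0" using assms by (simp add: K_def)
  have n: "normal_density 0 \<sigma> z = K * exp (- z\<^sup>2 / (2 * \<sigma>\<^sup>2))" for z
    by (simp add: normal_density_def K_def)
  have "K powr t * K powr (1 - t) = K"
    using K by (simp flip: powr_add)
  moreover have "exp (- x\<^sup>2 / (2 * \<sigma>\<^sup>2)) powr t * exp (- y\<^sup>2 / (2 * \<sigma>\<^sup>2)) powr (1 - t) =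
      exp (- (t * (1 - t) * (x - y)\<^sup>2 / (2 * \<sigma>\<^sup>2))) * exp (- (t * x + (1 - t) * y)\<^sup>2 / (2 * \<sigma>\<^sup>2))"
    unfolding powr_def using assms
    by (simp add: exp_add[symmetric] field_simps power2_eq_square)
  ultimately show ?thesis
    unfolding n using K by (simp add: powr_mult algebra_simps)
qed

text \<open>The inequality above for \<open>u\<close> times the density, the density itself, and \<open>w\<close> times the density. The middle
function has integral 1, and the Gaussian cost in the hypothesis is the loss in log-concavity.\<close>

lemma prekopa_leindler_normal_real:
  fixes u w :: "real \<Rightarrow> real"
  assumes \<sigma>: "\<sigma> > 0"
    and [measurable]: "u \<in> borel_measurable borel" "w \<in> borel_measurable borel"
    and u: "\<And>x. 0 \<le> u x" "\<And>x. u x \<le> B" and w: "\<And>x. 0 \<le> w x" "\<And>x. w x \<le> B"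
    and t: "0 < t" "t < 1"
    and le: "\<And>x y. u x powr t * exp (- (t * (1 - t) * (x - y)\<^sup>2 / (2 * \<sigma>\<^sup>2))) \<le> w (t * x + (1 - t) * y)"
  shows "(\<integral>x. u x \<partial>normal_measure \<sigma>) powr t \<le> (\<integral>x. w x \<partial>normal_measure \<sigma>)"
proof -
  let ?n = "normal_density 0 \<sigma>"
  have n_le: "?n x \<le> 1 / sqrt (2 * pi * \<sigma>\<^sup>2)" for x
    using \<sigma> by (auto simp: normal_density_def intro!: divide_right_mono)
  have B: "0 \<le> B" using u[of 0] by linarith
  have int: "integrable lborel (\<lambda>x. ?n x * v x)"
    if "v \<in> borel_measurable borel" "\<And>x. 0 \<le> v x" "\<And>x. v x \<le> B" for v
  proof (rule Bochner_Integration.integrable_bound)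
    show "integrable lborel (\<lambda>x. B * ?n x)"
      using \<sigma> by auto
  qed (use that B in \<open>auto simp: abs_mult mult.commute intro!: mult_mono\<close>)
  have "(\<integral>x. ?n x * u x \<partial>lborel) powr t * (\<integral>x. ?n x \<partial>lborel) powr (1 - t) \<le> (\<integral>x. ?n x * w x \<partial>lborel)"
  proof (rule prekopa_leindler_real)
    show "bdd_above (range ?n)" using n_le by (intro bdd_aboveI2)
    show "bdd_above (range (\<lambda>x. ?n x * u x))"
      using n_le u by (intro bdd_aboveI2[of _ _ "1 / sqrt (2 * pi * \<sigma>\<^sup>2) * B"] mult_mono) auto
    fix x y
    have "(?n x * u x) powr t * ?n y powr (1 - t) = u x powr t * (?n x powr t * ?n y powr (1 - t))"
      using u by (simp add: powr_mult)
    also have "\<dots> = (u x powr t * exp (- (t * (1 - t) * (x - y)\<^sup>2 / (2 * \<sigma>\<^sup>2)))) * ?n (t * x + (1 - t) * y)"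
      unfolding normal_density_convex_combination[OF \<sigma>] by simp
    also have "\<dots> \<le> w (t * x + (1 - t) * y) * ?n (t * x + (1 - t) * y)"
      by (intro mult_right_mono le) auto
    finally show "(?n x * u x) powr t * ?n y powr (1 - t) \<le> ?n (t * x + (1 - t) * y) * w (t * x + (1 - t) * y)"
      by (simp add: mult.commute)
  qed (use int u w t \<sigma> in auto)
  then show ?thesis
    using \<sigma> by (simp add: integral_density)
qed

text \<open>Integrating out all coordinates but one by the induction hypothesis leaves functions \<open>U\<close> and \<open>W\<close> of one variable
that again satisfy the hypothesis: for fixed values \<open>a\<close> and \<open>b\<close> of that variable the cost splits as a sum, and
its contribution from \<open>a\<close> and \<open>b\<close> is a constant that can be absorbed into \<open>u\<close>. Only two functions have to be
carried through the induction, because the constant function 1 stays constant when a coordinate is frozen.\<close>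

theorem prekopa_leindler_normal_product:
  fixes u w :: "('i \<Rightarrow> real) \<Rightarrow> real"
  assumes \<sigma>: "\<sigma> > 0" and t: "0 < t" "t < 1" and "finite I"
    and "u \<in> borel_measurable (PiM I (\<lambda>_. normal_measure \<sigma>))" "w \<in> borel_measurable (PiM I (\<lambda>_. normal_measure \<sigma>))"
    and "\<And>x. 0 \<le> u x" "\<And>x. u x \<le> B" and "\<And>x. 0 \<le> w x" "\<And>x. w x \<le> B"
    and "\<And>x y z. (\<And>i. i \<in> I \<Longrightarrow> z i = t * x i + (1 - t) * y i) \<Longrightarrow>
      x \<in> space (PiM I (\<lambda>_. normal_measure \<sigma>)) \<Longrightarrow> z \<in> space (PiM I (\<lambda>_. normal_measure \<sigma>)) \<Longrightarrow>
      u x powr t * exp (- (t * (1 - t) * (\<Sum>i\<in>I. (x i - y i)\<^sup>2) / (2 * \<sigma>\<^sup>2))) \<le> w z"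
  shows "(\<integral>x. u x \<partial>PiM I (\<lambda>_. normal_measure \<sigma>)) powr t \<le> (\<integral>x. w x \<partial>PiM I (\<lambda>_. normal_measure \<sigma>))"
  using assms(4-)
proof (induction I arbitrary: u w B rule: finite_induct)
  case empty
  then show ?case
    using empty(7)[of "\<lambda>_. undefined" "\<lambda>_. undefined"] by (simp add: PiM_empty lebesgue_integral_count_space_finite)
next
  case (insert j I)
  interpret N: prob_space "normal_measure \<sigma>"
    using prob_space_normal_density[OF \<sigma>] .
  interpret P: product_prob_space "\<lambda>_. normal_measure \<sigma>" by unfold_locales
  interpret PI: prob_space "PiM I (\<lambda>_. normal_measure \<sigma>)" by (intro prob_space_PiM N.prob_space_axioms)
  interpret PJ: prob_space "PiM (insert j I) (\<lambda>_. normal_measure \<sigma>)" by (intro prob_space_PiM N.prob_space_axioms)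
  interpret Q: pair_sigma_finite "PiM I (\<lambda>_. normal_measure \<sigma>)" "normal_measure \<sigma>" ..
  interpret QP: pair_prob_space "PiM I (\<lambda>_. normal_measure \<sigma>)" "normal_measure \<sigma>" ..
  let ?P = "PiM I (\<lambda>_. normal_measure \<sigma>)" and ?N = "normal_measure \<sigma>"
  note [measurable] = insert.prems(1,2)
  define U where "U a = (\<integral>x. u (x(j := a)) \<partial>?P)" for a
  define W where "W a = (\<integral>x. w (x(j := a)) \<partial>?P)" for a
  have swap: "(\<integral>x. v x \<partial>PiM (insert j I) (\<lambda>_. ?N)) = (\<integral>a. (\<integral>x. v (x(j := a)) \<partial>?P) \<partial>?N)"
    if [measurable]: "v \<in> borel_measurable (PiM (insert j I) (\<lambda>_. ?N))" and v: "\<And>x. 0 \<le> v x" "\<And>x. v x \<le> B" for v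
  proof -
    have "integrable (PiM (insert j I) (\<lambda>_. ?N)) v"
      by (rule PJ.integrable_const_bound[of _ B]) (use v in auto)
    then have "(\<integral>x. v x \<partial>PiM (insert j I) (\<lambda>_. ?N)) = (\<integral>x. (\<integral>a. v (x(j := a)) \<partial>?N) \<partial>?P)"
      by (rule P.product_integral_insert[OF insert.hyps])
    also have "\<dots> = (\<integral>a. (\<integral>x. v (x(j := a)) \<partial>?P) \<partial>?N)"
    proof (rule Q.Fubini_integral[symmetric])
      show "integrable (?P \<Otimes>\<^sub>M ?N) (\<lambda>(x, a). v (x(j := a)))"
        by (rule QP.integrable_const_bound[of _ B]) (use v in auto)
    qed
    finally show ?thesis .
  qed
  have bound: "0 \<le> (\<integral>x. v (x(j := a)) \<partial>?P)" "(\<integral>x. v (x(j := a)) \<partial>?P) \<le> B"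
    if [measurable]: "v \<in> borel_measurable (PiM (insert j I) (\<lambda>_. ?N))" and v: "\<And>x. 0 \<le> v x" "\<And>x. v x \<le> B" for v a
    using v by (auto intro!: PI.integral_le_const PI.integrable_const_bound[of _ B])
  have "(\<integral>a. U a \<partial>?N) powr t \<le> (\<integral>a. W a \<partial>?N)"
  proof (rule prekopa_leindler_normal_real[OF \<sigma>])
    show "U \<in> borel_measurable borel" "W \<in> borel_measurable borel"
      unfolding U_def W_def by measurable
    show "0 \<le> U a" "U a \<le> B" "0 \<le> W a" "W a \<le> B" for a
      unfolding U_def W_def using insert.prems by (auto intro!: bound)
    fix a b
    \<comment> \<open>The factor whose power \<open>t\<close> is the part of the cost that comes from the frozen coordinate.\<close>
    define c where "c = exp (- ((1 - t) * (a - b)\<^sup>2 / (2 * \<sigma>\<^sup>2)))"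
    have c: "0 < c" "c \<le> 1" using t by (auto simp: c_def)
    have ct: "c powr t = exp (- (t * (1 - t) * (a - b)\<^sup>2 / (2 * \<sigma>\<^sup>2)))"
      by (simp add: c_def powr_def mult_ac)
    have "(\<integral>x. c * u (x(j := a)) \<partial>?P) powr t \<le> (\<integral>x. w (x(j := t * a + (1 - t) * b)) \<partial>?P)"
    proof (rule insert.IH)
      show "(\<lambda>x. c * u (x(j := a))) \<in> borel_measurable ?P" by measurable
      show "(\<lambda>x. w (x(j := t * a + (1 - t) * b))) \<in> borel_measurable ?P" by measurable
      show "c * u (x(j := a)) \<le> B" for x
        using mult_mono[of c 1 "u (x(j := a))" B] c insert.prems(3,4) by simp
      fix x y z
      assume z: "\<And>i. i \<in> I \<Longrightarrow> z i = t * x i + (1 - t) * y i"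
        and x: "x \<in> space ?P" and zs: "z \<in> space ?P"
      have "exp (- (t * (1 - t) * (a - b)\<^sup>2 / (2 * \<sigma>\<^sup>2))) * exp (- (t * (1 - t) * (\<Sum>i\<in>I. (x i - y i)\<^sup>2) / (2 * \<sigma>\<^sup>2)))
          = exp (- (t * (1 - t) * ((a - b)\<^sup>2 + (\<Sum>i\<in>I. (x i - y i)\<^sup>2)) / (2 * \<sigma>\<^sup>2)))"
        by (simp add: exp_add[symmetric] distrib_left add_divide_distrib)
      then have "(c * u (x(j := a))) powr t * exp (- (t * (1 - t) * (\<Sum>i\<in>I. (x i - y i)\<^sup>2) / (2 * \<sigma>\<^sup>2)))
          = u (x(j := a)) powr t * exp (- (t * (1 - t) * ((a - b)\<^sup>2 + (\<Sum>i\<in>I. (x i - y i)\<^sup>2)) / (2 * \<sigma>\<^sup>2)))"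
        using c insert.prems(3) by (simp add: powr_mult ct)
      also have "(a - b)\<^sup>2 + (\<Sum>i\<in>I. (x i - y i)\<^sup>2) = (\<Sum>i\<in>insert j I. ((x(j := a)) i - (y(j := b)) i)\<^sup>2)"
        using insert.hyps by (auto intro!: sum.cong)
      also have "u (x(j := a)) powr t * exp (- (t * (1 - t) * \<dots> / (2 * \<sigma>\<^sup>2))) \<le> w (z(j := t * a + (1 - t) * b))"
        using z x zs insert.hyps
        by (intro insert.prems(7)) (auto simp: space_PiM PiE_def extensional_def)
      finally show "(c * u (x(j := a))) powr t * exp (- (t * (1 - t) * (\<Sum>i\<in>I. (x i - y i)\<^sup>2) / (2 * \<sigma>\<^sup>2)))
          \<le> w (z(j := t * a + (1 - t) * b))" .
    qed (use c insert.prems in auto)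
    moreover have "(\<integral>x. c * u (x(j := a)) \<partial>?P) powr t = U a powr t * c powr t"
      using c bound(1)[OF insert.prems(1,3,4)] by (simp add: U_def powr_mult mult.commute)
    ultimately show "U a powr t * exp (- (t * (1 - t) * (a - b)\<^sup>2 / (2 * \<sigma>\<^sup>2))) \<le> W (t * a + (1 - t) * b)"
      by (simp add: ct W_def)
  qed (use t in auto)
  then show ?case
    unfolding U_def W_def using insert.prems by (simp add: swap)
qed

section \<open>Concentration of Lipschitz functions of a Gaussian vector\<close>

lemma exp_le_quadratic:
  fixes v :: real
  assumes "v \<le> 1"
  shows "exp v \<le> 1 + v + v\<^sup>2"
proof (cases "0 \<le> v")
  case True
  then show ?thesis using exp_bound[of v] assms by simp
next
  case False
  have "exp v * (1 - v) \<le> exp v * exp (- v)"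
    using exp_ge_add_one_self[of "- v"] by (intro mult_left_mono) auto
  also have "\<dots> = 1" by (simp flip: exp_add)
  also have "1 \<le> (1 + v + v\<^sup>2) * (1 - v)"
  proof -
    have "(1 + v + v\<^sup>2) * (1 - v) = 1 - v ^ 3" by (simp add: algebra_simps power2_eq_square power3_eq_cube)
    moreover have "v ^ 3 \<le> 0" using False by (simp add: power3_eq_cube mult_nonneg_nonpos)
    ultimately show ?thesis by simp
  qed
  finally show ?thesis using False by simp
qed

locale gaussian_vector = prob_space M for M :: "'a measure" +
  fixes \<xi> :: "'a \<Rightarrow> real ^ 'n" and \<sigma> :: real
  assumes sigma_pos: "\<sigma> > 0"
    and distributed: "distributed M lborel \<xi> (\<lambda>x. ennreal (iso_normal_density \<sigma> x))"
begin

lemma measurable_vec [measurable]: "\<xi> \<in> borel_measurable M"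
  using distributed_measurable[OF distributed] by simp

lemma measurable_coord [measurable]: "(\<lambda>\<omega>. \<xi> \<omega> $ i) \<in> borel_measurable M"
  using measurable_compose[OF measurable_vec, of "\<lambda>x. x $ i" borel] by simp

text \<open>Both measures agree on boxes, since the density and the indicator of a box factorize.\<close>

lemma distr_coords: "distr M (PiM UNIV (\<lambda>_. normal_measure \<sigma>)) (\<lambda>\<omega> i. \<xi> \<omega> $ i) = PiM UNIV (\<lambda>_. normal_measure \<sigma>)"
proof -
  interpret N: prob_space "normal_measure \<sigma>"
    using prob_space_normal_density[OF sigma_pos] .
  interpret P: product_prob_space "\<lambda>_::'n. normal_measure \<sigma>" by unfold_locales
  have meas: "(\<lambda>\<omega> i. \<xi> \<omega> $ i) \<in> measurable M (PiM UNIV (\<lambda>_. normal_measure \<sigma>))"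
    by (rule measurable_PiM_single') (auto simp: space_PiM)
  show ?thesis
  proof (rule P.PiM_eqI)
    fix A :: "'n \<Rightarrow> real set" assume "\<And>i. i \<in> UNIV \<Longrightarrow> A i \<in> sets (normal_measure \<sigma>)"
    then have [measurable]: "A i \<in> sets borel" for i by simp
    have box: "Pi\<^sub>E UNIV A \<in> sets (PiM UNIV (\<lambda>_. normal_measure \<sigma>))"
      by (intro sets_PiM_I_finite) auto
    define q where "q b r = ennreal (normal_density 0 \<sigma> r) * indicator (A (axis_index b)) r" for b :: "real ^ 'n" and r :: real
    have Basis: "(Basis :: (real ^ 'n) set) = range (\<lambda>i. axis i 1)"
      by (auto simp: Basis_vec_def)
    have inj: "inj (\<lambda>i::'n. axis i (1::real))"
      by (auto simp: inj_def axis_eq_axis)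
    have prodB: "(\<Prod>b\<in>Basis. g b) = (\<Prod>i\<in>UNIV. g (axis i 1))" for g :: "real ^ 'n \<Rightarrow> ennreal"
      unfolding Basis by (subst prod.reindex[OF inj]) simp
    have "emeasure (distr M (PiM UNIV (\<lambda>_. normal_measure \<sigma>)) (\<lambda>\<omega> i. \<xi> \<omega> $ i)) (Pi\<^sub>E UNIV A)
        = emeasure M (\<xi> -` {x. \<forall>i. x $ i \<in> A i} \<inter> space M)"
      using box meas by (subst emeasure_distr) (auto intro!: arg_cong[of _ _ "emeasure M"])
    also have "\<dots> = (\<integral>\<^sup>+x. ennreal (iso_normal_density \<sigma> x) * indicator {x. \<forall>i. x $ i \<in> A i} x \<partial>lborel)"
      by (rule distributed_emeasure[OF distributed]) measurable
    also have "\<dots> = (\<integral>\<^sup>+x. (\<Prod>b\<in>Basis. q b (x \<bullet> b)) \<partial>lborel)"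
    proof (rule nn_integral_cong)
      fix x :: "real ^ 'n"
      have "(\<Prod>i\<in>UNIV. indicator (A i) (x $ i) :: ennreal) = indicator {x. \<forall>i. x $ i \<in> A i} x"
        by (auto simp: indicator_def)
      then show "ennreal (iso_normal_density \<sigma> x) * indicator {x. \<forall>i. x $ i \<in> A i} x = (\<Prod>b\<in>Basis. q b (x \<bullet> b))"
        unfolding prodB by (simp add: q_def iso_normal_density_def prod_ennreal prod.distrib inner_axis)
    qed
    also have "\<dots> = (\<Prod>b\<in>Basis. \<integral>\<^sup>+r. q b r \<partial>lborel)"
      by (rule nn_integral_lborel_prod) (auto simp: q_def)
    also have "\<dots> = (\<Prod>i\<in>UNIV. emeasure (normal_measure \<sigma>) (A i))"
      unfolding prodB by (simp add: q_def[abs_def] emeasure_density)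
    finally show "emeasure (distr M (PiM UNIV (\<lambda>_. normal_measure \<sigma>)) (\<lambda>\<omega> i. \<xi> \<omega> $ i)) (Pi\<^sub>E UNIV A)
        = (\<Prod>i\<in>UNIV. emeasure (normal_measure \<sigma>) (A i))" .
  qed auto
qed

lemma integral_coords:
  fixes F :: "real ^ 'n \<Rightarrow> real"
  assumes [measurable]: "F \<in> borel_measurable borel"
  shows "expectation (\<lambda>\<omega>. F (\<xi> \<omega>)) = (\<integral>x. F (\<chi> i. x i) \<partial>PiM UNIV (\<lambda>_. normal_measure \<sigma>))"
    and "(\<lambda>x. F (\<chi> i. x i)) \<in> borel_measurable (PiM UNIV (\<lambda>_. normal_measure \<sigma>))"
proof -
  have "(\<lambda>x. \<chi> i. x i) \<in> borel_measurable (PiM UNIV (\<lambda>_::'n. normal_measure \<sigma>))"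
  proof (rule borel_measurable_euclidean_space[THEN iffD2], intro ballI)
    fix b :: "real ^ 'n" assume "b \<in> Basis"
    then obtain i where "b = axis i 1" by (auto simp: Basis_vec_def)
    then show "(\<lambda>x. (\<chi> i. x i) \<bullet> b) \<in> borel_measurable (PiM UNIV (\<lambda>_::'n. normal_measure \<sigma>))"
      using measurable_component_singleton[of i UNIV "\<lambda>_. normal_measure \<sigma>"]
      by (simp add: inner_axis cong: measurable_cong_sets)
  qed
  then show m: "(\<lambda>x. F (\<chi> i. x i)) \<in> borel_measurable (PiM UNIV (\<lambda>_. normal_measure \<sigma>))"
    by (rule measurable_compose) simp
  have "(\<lambda>\<omega> i. \<xi> \<omega> $ i) \<in> measurable M (PiM UNIV (\<lambda>_. normal_measure \<sigma>))"
    by (rule measurable_PiM_single') (auto simp: space_PiM)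
  then show "expectation (\<lambda>\<omega>. F (\<xi> \<omega>)) = (\<integral>x. F (\<chi> i. x i) \<partial>PiM UNIV (\<lambda>_. normal_measure \<sigma>))"
    using m by (subst distr_coords[symmetric], subst integral_distr) auto
qed

text \<open>With \<open>u = exp F\<close> and \<open>w\<close> a multiple of \<open>exp (t F)\<close>, the hypothesis of the product inequality reduces, for
\<open>D = |x - y|\<close>, to \<open>L D - D\<^sup>2 / (2 \<sigma>\<^sup>2) \<le> L\<^sup>2 \<sigma>\<^sup>2 / 2\<close>: the intermediate point is at distance \<open>(1 - t) D\<close> from \<open>x\<close>.\<close>

lemma lipschitz_exp_power:
  fixes F :: "real ^ 'n \<Rightarrow> real"
  assumes lip: "L-lipschitz_on UNIV F" and bnd: "\<And>x. \<bar>F x\<bar> \<le> B" and t: "0 < t" "t < 1"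
  shows "expectation (\<lambda>\<omega>. exp (F (\<xi> \<omega>))) powr t \<le>
    exp (t * (1 - t) * L\<^sup>2 * \<sigma>\<^sup>2 / 2) * expectation (\<lambda>\<omega>. exp (t * F (\<xi> \<omega>)))"
proof -
  have [measurable]: "F \<in> borel_measurable borel"
    by (intro borel_measurable_continuous_onI lipschitz_on_continuous_on[OF lip])
  define k where "k = t * (1 - t) * L\<^sup>2 * \<sigma>\<^sup>2 / 2"
  have k: "0 \<le> k" using t by (simp add: k_def)
  have B: "0 \<le> B" using bnd[of 0] by linarith
  have "(\<integral>x. exp (F (\<chi> i. x i)) \<partial>PiM UNIV (\<lambda>_. normal_measure \<sigma>)) powr t \<le>
      (\<integral>x. exp (k + t * F (\<chi> i. x i)) \<partial>PiM UNIV (\<lambda>_. normal_measure \<sigma>))"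
  proof (rule prekopa_leindler_normal_product[OF sigma_pos t])
    show "(\<lambda>x. exp (F (\<chi> i. x i))) \<in> borel_measurable (PiM UNIV (\<lambda>_. normal_measure \<sigma>))"
      "(\<lambda>x. exp (k + t * F (\<chi> i. x i))) \<in> borel_measurable (PiM UNIV (\<lambda>_. normal_measure \<sigma>))"
      by (rule integral_coords(2); measurable)+
    show "exp (F (\<chi> i. x i)) \<le> exp (k + B)" for x
      using bnd[of "\<chi> i. x i"] k by simp
    show "exp (k + t * F (\<chi> i. x i)) \<le> exp (k + B)" for x
    proof -
      have "t * F (\<chi> i. x i) \<le> t * B"
        using bnd[of "\<chi> i. x i"] t by (intro mult_left_mono) auto
      also have "\<dots> \<le> B"
        using t B by (intro mult_left_le_one_le) auto
      finally show ?thesis by simp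
    qed
    fix x y z :: "'n \<Rightarrow> real"
    assume z: "\<And>i. i \<in> UNIV \<Longrightarrow> z i = t * x i + (1 - t) * y i"
    let ?x = "\<chi> i. x i" and ?y = "\<chi> i. y i" and ?z = "\<chi> i. z i"
    define D where "D = norm (?x - ?y)"
    have D: "(\<Sum>i\<in>UNIV. (x i - y i)\<^sup>2) = D\<^sup>2"
      unfolding D_def norm_vec_def by (simp add: L2_set_def sum_nonneg)
    have "?x - ?z = (1 - t) *\<^sub>R (?x - ?y)"
      using z by (simp add: vec_eq_iff algebra_simps)
    then have "norm (?x - ?z) = (1 - t) * D"
      using t by (simp add: D_def)
    then have "F ?x - F ?z \<le> L * ((1 - t) * D)"
      using lipschitz_onD[OF lip, of ?x ?z] by (simp add: dist_norm)
    then have "t * (F ?x - F ?z) \<le> t * (L * ((1 - t) * D))"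
      using t by (intro mult_left_mono) auto
    moreover have "t * (1 - t) * (L * D - D\<^sup>2 / (2 * \<sigma>\<^sup>2) - L\<^sup>2 * \<sigma>\<^sup>2 / 2) \<le> 0"
    proof -
      have "L * D - D\<^sup>2 / (2 * \<sigma>\<^sup>2) - L\<^sup>2 * \<sigma>\<^sup>2 / 2 = - ((D / \<sigma> - L * \<sigma>)\<^sup>2 / 2)"
        using sigma_pos by (simp add: power2_eq_square field_simps)
      then show ?thesis
        using t by (simp add: mult_nonneg_nonneg)
    qed
    ultimately have "t * F ?x - t * (1 - t) * D\<^sup>2 / (2 * \<sigma>\<^sup>2) \<le> k + t * F ?z"
      by (simp add: k_def algebra_simps)
    then show "exp (F ?x) powr t * exp (- (t * (1 - t) * (\<Sum>i\<in>UNIV. (x i - y i)\<^sup>2) / (2 * \<sigma>\<^sup>2))) \<le> exp (k + t * F ?z)"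
      unfolding D by (simp add: powr_def exp_add[symmetric])
  qed auto
  moreover have "expectation (\<lambda>\<omega>. exp (F (\<xi> \<omega>))) = (\<integral>x. exp (F (\<chi> i. x i)) \<partial>PiM UNIV (\<lambda>_. normal_measure \<sigma>))"
    "expectation (\<lambda>\<omega>. exp (t * F (\<xi> \<omega>))) = (\<integral>x. exp (t * F (\<chi> i. x i)) \<partial>PiM UNIV (\<lambda>_. normal_measure \<sigma>))"
    by (rule integral_coords(1), measurable)+
  ultimately show ?thesis
    by (simp add: exp_add k_def)
qed

text \<open>Take logarithms in the preceding lemma, divide by \<open>t\<close> and let \<open>t\<close> tend to 0. Since \<open>F\<close> is bounded,
for small \<open>t\<close> one has \<open>ln (E exp (t F)) \<le> t E F + t\<^sup>2 B\<^sup>2\<close>, so its quotient by \<open>t\<close> is asymptotically at most \<open>E F\<close>.\<close>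

theorem lipschitz_mgf:
  fixes F :: "real ^ 'n \<Rightarrow> real"
  assumes lip: "L-lipschitz_on UNIV F" and bnd: "\<And>x. \<bar>F x\<bar> \<le> B"
  shows "expectation (\<lambda>\<omega>. exp (F (\<xi> \<omega>))) \<le> exp (expectation (\<lambda>\<omega>. F (\<xi> \<omega>)) + L\<^sup>2 * \<sigma>\<^sup>2 / 2)"
proof -
  have [measurable]: "F \<in> borel_measurable borel"
    by (intro borel_measurable_continuous_onI lipschitz_on_continuous_on[OF lip])
  define E where "E = expectation (\<lambda>\<omega>. F (\<xi> \<omega>))"
  define Z where "Z = expectation (\<lambda>\<omega>. exp (F (\<xi> \<omega>)))"
  have B: "0 \<le> B" using bnd[of 0] by linarith
  have int: "integrable M (\<lambda>\<omega>. F (\<xi> \<omega>))"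
    by (rule integrable_const_bound[of _ B]) (use bnd in auto)
  have int_exp: "integrable M (\<lambda>\<omega>. exp (t * F (\<xi> \<omega>)))" if "0 \<le> t" for t
  proof (rule integrable_const_bound[of _ "exp (t * B)"])
    have "t * F x \<le> t * B" for x
      using bnd[of x] that by (intro mult_left_mono) auto
    then show "AE \<omega> in M. norm (exp (t * F (\<xi> \<omega>))) \<le> exp (t * B)" by simp
  qed auto
  have "exp (- B) \<le> Z"
    unfolding Z_def using int_exp[of 1] bnd
    by (intro integral_ge_const) (auto simp: minus_le_iff abs_le_iff)
  then have Z: "0 < Z"
    using exp_gt_zero[of "- B"] by linarith
  have main: "ln Z \<le> (1 - t) * L\<^sup>2 * \<sigma>\<^sup>2 / 2 + E + t * B\<^sup>2" if t: "0 < t" "t < 1" "t * B \<le> 1" for t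
  proof -
    have le: "exp (t * F x) \<le> 1 + t * F x + t\<^sup>2 * B\<^sup>2" for x
    proof -
      have "t * F x \<le> t * B"
        using bnd[of x] t by (intro mult_left_mono) auto
      then have "exp (t * F x) \<le> 1 + t * F x + (t * F x)\<^sup>2"
        using t by (intro exp_le_quadratic) linarith
      moreover have "(F x)\<^sup>2 \<le> B\<^sup>2"
        using bnd[of x] B by (simp add: abs_le_square_iff[symmetric])
      ultimately show ?thesis
        using mult_left_mono[of "(F x)\<^sup>2" "B\<^sup>2" "t\<^sup>2"] by (simp add: power_mult_distrib)
    qed
    have "expectation (\<lambda>\<omega>. exp (t * F (\<xi> \<omega>))) \<le> expectation (\<lambda>\<omega>. 1 + t * F (\<xi> \<omega>) + t\<^sup>2 * B\<^sup>2)"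
      using int int_exp[of t] t le by (intro integral_mono) auto
    also have "\<dots> = 1 + (t * E + t\<^sup>2 * B\<^sup>2)"
      using int by (simp add: E_def prob_space)
    also have "\<dots> \<le> exp (t * E + t\<^sup>2 * B\<^sup>2)"
      by (rule exp_ge_add_one_self)
    finally have "Z powr t \<le> exp (t * (1 - t) * L\<^sup>2 * \<sigma>\<^sup>2 / 2) * exp (t * E + t\<^sup>2 * B\<^sup>2)"
      using lipschitz_exp_power[OF lip bnd t(1,2)] unfolding Z_def
      by (meson exp_ge_zero mult_left_mono order_trans)
    then have "exp (t * ln Z) \<le> exp (t * ((1 - t) * L\<^sup>2 * \<sigma>\<^sup>2 / 2 + E + t * B\<^sup>2))"
      using Z by (simp add: powr_def exp_add[symmetric] algebra_simps power2_eq_square)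
    then show ?thesis
      using t by simp
  qed
  have lim: "((\<lambda>t. (1 - t) * L\<^sup>2 * \<sigma>\<^sup>2 / 2 + E + t * B\<^sup>2) \<longlongrightarrow> (1 - 0) * L\<^sup>2 * \<sigma>\<^sup>2 / 2 + E + 0 * B\<^sup>2) (at_right 0)"
    by (intro tendsto_intros) auto
  have "eventually (\<lambda>t::real. t \<in> {0<..<1 / (1 + B)}) (at_right 0)"
    using B by (intro eventually_at_rightI) auto
  then have "eventually (\<lambda>t. ln Z \<le> (1 - t) * L\<^sup>2 * \<sigma>\<^sup>2 / 2 + E + t * B\<^sup>2) (at_right 0)"
  proof eventually_elim
    case (elim t)
    then have "t * (1 + B) < 1" "0 < t" using B by (auto simp: field_simps)
    then show ?case
      using B by (intro main) (auto simp: distrib_left intro: order_less_imp_le le_less_trans[of t "t + t * B"])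
  qed
  then have "ln Z \<le> (1 - 0) * L\<^sup>2 * \<sigma>\<^sup>2 / 2 + E + 0 * B\<^sup>2"
    by (rule tendsto_lowerbound[OF lim]) simp
  then have "exp (ln Z) \<le> exp (E + L\<^sup>2 * \<sigma>\<^sup>2 / 2)"
    by simp
  then show ?thesis
    using Z unfolding Z_def[symmetric] E_def[symmetric] by simp
qed

text \<open>Chernoff bound with the optimal parameter \<open>r / (L \<sigma>)\<close>.\<close>

theorem lipschitz_upper_tail:
  fixes F :: "real ^ 'n \<Rightarrow> real"
  assumes lip: "L-lipschitz_on UNIV F" and bnd: "\<And>x. \<bar>F x\<bar> \<le> B" and "0 < L" "0 \<le> r"
  shows "prob {\<omega> \<in> space M. expectation (\<lambda>\<omega>. F (\<xi> \<omega>)) + L * \<sigma> * r \<le> F (\<xi> \<omega>)} \<le> exp (- r\<^sup>2 / 2)"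
proof -
  have [measurable]: "F \<in> borel_measurable borel"
    by (intro borel_measurable_continuous_onI lipschitz_on_continuous_on[OF lip])
  define E where "E = expectation (\<lambda>\<omega>. F (\<xi> \<omega>))"
  define l where "l = r / (L * \<sigma>)"
  have l: "0 \<le> l" using assms sigma_pos by (simp add: l_def)
  have "prob {\<omega> \<in> space M. E + L * \<sigma> * r \<le> F (\<xi> \<omega>)}
      \<le> prob {\<omega> \<in> space M. exp (l * (E + L * \<sigma> * r)) \<le> exp (l * F (\<xi> \<omega>))}"
    using l by (intro finite_measure_mono) (auto intro: mult_left_mono)
  also have "\<dots> \<le> expectation (\<lambda>\<omega>. exp (l * F (\<xi> \<omega>))) / exp (l * (E + L * \<sigma> * r))"
  proof (rule integral_Markov_inequality_measure[where A = "{}"])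
    have "l * F x \<le> l * B" for x
      using bnd[of x] l by (intro mult_left_mono) auto
    then show "integrable M (\<lambda>\<omega>. exp (l * F (\<xi> \<omega>)))"
      by (intro integrable_const_bound[of _ "exp (l * B)"]) auto
  qed auto
  also have "\<dots> \<le> exp (l * E + (l * L)\<^sup>2 * \<sigma>\<^sup>2 / 2) / exp (l * (E + L * \<sigma> * r))"
  proof (intro divide_right_mono)
    have "(\<bar>l\<bar> * L)-lipschitz_on UNIV (\<lambda>x. l *\<^sub>R F x)"
      by (intro lipschitz_intros lip)
    then have "(l * L)-lipschitz_on UNIV (\<lambda>x. l * F x)"
      using l by simp
    moreover have "\<bar>l * F x\<bar> \<le> l * B" for x
      using bnd[of x] l by (simp add: abs_mult mult_left_mono)
    ultimately show "expectation (\<lambda>\<omega>. exp (l * F (\<xi> \<omega>))) \<le> exp (l * E + (l * L)\<^sup>2 * \<sigma>\<^sup>2 / 2)"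
      using lipschitz_mgf[of "l * L" "\<lambda>x. l * F x" "l * B"] by (simp add: E_def)
  qed auto
  also have "\<dots> = exp (l * E + (l * L)\<^sup>2 * \<sigma>\<^sup>2 / 2 - l * (E + L * \<sigma> * r))"
    by (simp add: exp_diff)
  also have "l * E + (l * L)\<^sup>2 * \<sigma>\<^sup>2 / 2 - l * (E + L * \<sigma> * r) = - r\<^sup>2 / 2"
    using assms sigma_pos by (simp add: l_def power2_eq_square field_simps)
  finally show ?thesis
    unfolding E_def .
qed

corollary lipschitz_lower_tail:
  fixes F :: "real ^ 'n \<Rightarrow> real"
  assumes lip: "L-lipschitz_on UNIV F" and bnd: "\<And>x. \<bar>F x\<bar> \<le> B" and "0 < L" "0 \<le> r"
  shows "prob {\<omega> \<in> space M. F (\<xi> \<omega>) \<le> expectation (\<lambda>\<omega>. F (\<xi> \<omega>)) - L * \<sigma> * r} \<le> exp (- r\<^sup>2 / 2)"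
proof -
  have "L-lipschitz_on UNIV (\<lambda>x. - F x)"
    using lip by (simp add: lipschitz_on_minus)
  then have "prob {\<omega> \<in> space M. expectation (\<lambda>\<omega>. - F (\<xi> \<omega>)) + L * \<sigma> * r \<le> - F (\<xi> \<omega>)} \<le> exp (- r\<^sup>2 / 2)"
    using assms by (intro lipschitz_upper_tail) auto
  also have "{\<omega> \<in> space M. expectation (\<lambda>\<omega>. - F (\<xi> \<omega>)) + L * \<sigma> * r \<le> - F (\<xi> \<omega>)} =
      {\<omega> \<in> space M. F (\<xi> \<omega>) \<le> expectation (\<lambda>\<omega>. F (\<xi> \<omega>)) - L * \<sigma> * r}"
    by (auto simp: algebra_simps)
  finally show ?thesis .
qed

end

section \<open>Linear functionals of a Gaussian vector\<close>

text \<open>On the range of integration \<open>x / r \<ge> 1\<close>, and \<open>x\<close> times the density has an explicit primitive. The factor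
\<open>1 / r\<close> cannot be dropped in the maximal inequality below: with the tail bound \<open>exp (- r\<^sup>2 / 2)\<close> alone, the union
bound at the level \<open>sqrt (2 ln p)\<close> is void.\<close>

lemma nn_integral_std_normal_tail:
  assumes "r > 0"
  shows "(\<integral>\<^sup>+x. ennreal (std_normal_density x) * indicator {r..} x \<partial>lborel) \<le> ennreal (exp (- r\<^sup>2 / 2) / (r * sqrt (2 * pi)))"
proof -
  have "(\<integral>\<^sup>+x. ennreal (std_normal_density x) * indicator {r..} x \<partial>lborel)
      \<le> (\<integral>\<^sup>+x. ennreal (x / r * std_normal_density x) * indicator {r..} x \<partial>lborel)"
  proof (intro nn_integral_mono)
    fix x
    show "ennreal (std_normal_density x) * indicator {r..} x \<le> ennreal (x / r * std_normal_density x) * indicator {r..} x"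
    proof (cases "r \<le> x")
      case True
      then have "1 * std_normal_density x \<le> x / r * std_normal_density x"
        using assms by (intro mult_right_mono) auto
      then show ?thesis
        using True by (simp add: ennreal_leI)
    qed simp
  qed
  also have "\<dots> = ennreal (0 - (- std_normal_density r / r))"
  proof (rule nn_integral_FTC_atLeast[where F = "\<lambda>x. - std_normal_density x / r"])
    fix x assume "r \<le> x"
    show "DERIV (\<lambda>x. - std_normal_density x / r) x :> x / r * std_normal_density x"
      unfolding std_normal_density_def using assms by (auto intro!: derivative_eq_intros simp: field_simps)
    show "0 \<le> x / r * std_normal_density x"
      using assms \<open>r \<le> x\<close> by simp
  next
    have "((\<lambda>x::real. exp (- x\<^sup>2 / 2)) \<longlongrightarrow> 0) at_top"
      by real_asymp
    then have "((\<lambda>x::real. - ((1 / sqrt (2 * pi)) * exp (- x\<^sup>2 / 2)) / r) \<longlongrightarrow> - ((1 / sqrt (2 * pi)) * 0) / r) at_top"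
      using assms by (intro tendsto_intros) auto
    then show "((\<lambda>x. - std_normal_density x / r) \<longlongrightarrow> 0) at_top"
      by (simp add: std_normal_density_def)
  qed auto
  also have "0 - (- std_normal_density r / r) = exp (- r\<^sup>2 / 2) / (r * sqrt (2 * pi))"
    by (simp add: std_normal_density_def)
  finally show ?thesis .
qed

context gaussian_vector
begin

lemma distributed_coord: "distributed M lborel (\<lambda>\<omega>. \<xi> \<omega> $ i) (normal_density 0 \<sigma>)"
proof -
  have N: "prob_space (normal_measure \<sigma>)"
    using prob_space_normal_density[OF sigma_pos] .
  have meas: "(\<lambda>\<omega> i. \<xi> \<omega> $ i) \<in> measurable M (PiM UNIV (\<lambda>_. normal_measure \<sigma>))"
    by (rule measurable_PiM_single') (auto simp: space_PiM)
  have "distr M lborel (\<lambda>\<omega>. \<xi> \<omega> $ i) = distr M (normal_measure \<sigma>) (\<lambda>\<omega>. \<xi> \<omega> $ i)"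
    by (intro distr_cong) auto
  also have "\<dots> = distr (distr M (PiM UNIV (\<lambda>_. normal_measure \<sigma>)) (\<lambda>\<omega> i. \<xi> \<omega> $ i)) (normal_measure \<sigma>) (\<lambda>x. x i)"
    using meas by (subst distr_distr) (auto simp: comp_def)
  also have "\<dots> = normal_measure \<sigma>"
    unfolding distr_coords by (rule distr_PiM_component) (use N in auto)
  finally show ?thesis
    by (simp add: distributed_def)
qed

lemma indep_coords: "indep_vars (\<lambda>_. borel) (\<lambda>i \<omega>. \<xi> \<omega> $ i) UNIV"
proof (subst indep_vars_iff_distr_eq_PiM)
  have eq: "distr M borel (\<lambda>\<omega>. \<xi> \<omega> $ i) = normal_measure \<sigma>" for i
    using distributed_distr_eq_density[OF distributed_coord[of i]] by (simp cong: distr_cong)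
  have "distr M (PiM UNIV (\<lambda>_. borel)) (\<lambda>\<omega>. \<lambda>i\<in>UNIV. \<xi> \<omega> $ i)
      = distr M (PiM UNIV (\<lambda>_. normal_measure \<sigma>)) (\<lambda>\<omega> i. \<xi> \<omega> $ i)"
    by (intro distr_cong sets_PiM_cong) auto
  then show "distr M (PiM UNIV (\<lambda>_. borel)) (\<lambda>\<omega>. \<lambda>i\<in>UNIV. \<xi> \<omega> $ i)
      = PiM UNIV (\<lambda>i. distr M borel (\<lambda>\<omega>. \<xi> \<omega> $ i))"
    by (simp add: eq distr_coords)
qed auto

lemma distributed_inner:
  assumes "a \<noteq> 0"
  shows "distributed M lborel (\<lambda>\<omega>. a \<bullet> \<xi> \<omega>) (normal_density 0 (norm a * \<sigma>))"
proof -
  \<comment> \<open>Zero coefficients contribute constants, which have no density, and are left out of the sum.\<close>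
  define I where "I = {i. a $ i \<noteq> 0}"
  have I: "finite I" "I \<noteq> {}"
    using assms by (auto simp: I_def vec_eq_iff)
  have "distributed M lborel (\<lambda>\<omega>. \<Sum>i\<in>I. a $ i * \<xi> \<omega> $ i)
      (normal_density (\<Sum>i\<in>I. 0) (sqrt (\<Sum>i\<in>I. (\<bar>a $ i\<bar> * \<sigma>)\<^sup>2)))"
  proof (rule sum_indep_normal)
    show "indep_vars (\<lambda>_. borel) (\<lambda>i \<omega>. a $ i * \<xi> \<omega> $ i) I"
      using indep_vars_compose2[OF indep_vars_subset[OF indep_coords, of I], of "\<lambda>i x. a $ i * x" "\<lambda>_. borel"] by simp
    show "distributed M lborel (\<lambda>\<omega>. a $ i * \<xi> \<omega> $ i) (normal_density 0 (\<bar>a $ i\<bar> * \<sigma>))" if "i \<in> I" for i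
      using normal_density_affine[OF distributed_coord sigma_pos, of "a $ i" 0 i] that by (simp add: I_def)
  qed (use I sigma_pos in \<open>auto simp: I_def\<close>)
  moreover have "(\<Sum>i\<in>I. a $ i * \<xi> \<omega> $ i) = a \<bullet> \<xi> \<omega>" for \<omega>
    unfolding inner_vec_def I_def by (auto intro!: sum.mono_neutral_left)
  moreover have "sqrt (\<Sum>i\<in>I. (\<bar>a $ i\<bar> * \<sigma>)\<^sup>2) = norm a * \<sigma>"
  proof -
    have "(\<Sum>i\<in>I. (\<bar>a $ i\<bar> * \<sigma>)\<^sup>2) = (\<Sum>i\<in>UNIV. (\<bar>a $ i\<bar> * \<sigma>)\<^sup>2)"
      unfolding I_def by (auto intro!: sum.mono_neutral_left)
    also have "\<dots> = (\<Sum>i\<in>UNIV. (a $ i)\<^sup>2) * \<sigma>\<^sup>2"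
      by (simp add: power_mult_distrib sum_distrib_right)
    finally show ?thesis
      using sigma_pos by (simp add: norm_vec_def L2_set_def real_sqrt_mult)
  qed
  ultimately show ?thesis by simp
qed

lemma integrable_inner_square: "integrable M (\<lambda>\<omega>. (a \<bullet> \<xi> \<omega>)\<^sup>2)"
  and expectation_inner_square: "expectation (\<lambda>\<omega>. (a \<bullet> \<xi> \<omega>)\<^sup>2) = (norm a)\<^sup>2 * \<sigma>\<^sup>2"
proof -
  have "integrable M (\<lambda>\<omega>. (a \<bullet> \<xi> \<omega>)\<^sup>2) \<and> expectation (\<lambda>\<omega>. (a \<bullet> \<xi> \<omega>)\<^sup>2) = (norm a)\<^sup>2 * \<sigma>\<^sup>2"
  proof (cases "a = 0")
    case False
    then have s: "0 < norm a * \<sigma>" using sigma_pos by simp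
    have 0: "expectation (\<lambda>\<omega>. a \<bullet> \<xi> \<omega>) = 0"
      by (rule normal_distributed_expectation[OF s distributed_inner[OF False]])
    have "integrable lborel (\<lambda>x. normal_density 0 (norm a * \<sigma>) x * x\<^sup>2)"
      using integrable_normal_moment[OF s, of 0 2] by simp
    then have "integrable M (\<lambda>\<omega>. (a \<bullet> \<xi> \<omega>)\<^sup>2)"
      by (subst distributed_integrable[OF distributed_inner[OF False], symmetric]) auto
    then show ?thesis
      using normal_distributed_variance[OF s distributed_inner[OF False]] 0 by (simp add: power_mult_distrib)
  qed auto
  then show "integrable M (\<lambda>\<omega>. (a \<bullet> \<xi> \<omega>)\<^sup>2)" "expectation (\<lambda>\<omega>. (a \<bullet> \<xi> \<omega>)\<^sup>2) = (norm a)\<^sup>2 * \<sigma>\<^sup>2" by auto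
qed

text \<open>An upper bound \<open>c\<close> on the norm, in place of the norm, gives one threshold for a family of vectors and covers the
degenerate case \<open>a = 0\<close>.\<close>

lemma inner_upper_tail:
  assumes r: "r > 0" and a: "norm a \<le> c"
  shows "prob {\<omega> \<in> space M. c * \<sigma> * r < a \<bullet> \<xi> \<omega>} \<le> exp (- r\<^sup>2 / 2) / (r * sqrt (2 * pi))"
proof (cases "a = 0")
  case True
  then have "{\<omega> \<in> space M. c * \<sigma> * r < a \<bullet> \<xi> \<omega>} = {}"
    using a r sigma_pos by (auto simp: not_less)
  then show ?thesis using r by (simp only: measure_empty) simp
next
  case False
  then have s: "0 < norm a * \<sigma>" using sigma_pos by simp
  have D: "distributed M lborel (\<lambda>\<omega>. (a \<bullet> \<xi> \<omega> - 0) / (norm a * \<sigma>)) std_normal_density"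
    using normal_standard_normal_convert[OF s, of "\<lambda>\<omega>. a \<bullet> \<xi> \<omega>" 0] distributed_inner[OF False] by simp
  have "ennreal (prob {\<omega> \<in> space M. c * \<sigma> * r < a \<bullet> \<xi> \<omega>})
      \<le> emeasure M ((\<lambda>\<omega>. (a \<bullet> \<xi> \<omega> - 0) / (norm a * \<sigma>)) -` {r..} \<inter> space M)"
    unfolding emeasure_eq_measure[symmetric]
  proof (intro emeasure_mono subsetI)
    fix \<omega> assume "\<omega> \<in> {\<omega> \<in> space M. c * \<sigma> * r < a \<bullet> \<xi> \<omega>}"
    moreover have "norm a * \<sigma> * r \<le> c * \<sigma> * r"
      using a r sigma_pos by (intro mult_right_mono) auto
    ultimately show "\<omega> \<in> (\<lambda>\<omega>. (a \<bullet> \<xi> \<omega> - 0) / (norm a * \<sigma>)) -` {r..} \<inter> space M"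
      using s by (auto simp: pos_le_divide_eq mult_ac)
  qed measurable
  also have "\<dots> = (\<integral>\<^sup>+x. ennreal (std_normal_density x) * indicator {r..} x \<partial>lborel)"
    by (rule distributed_emeasure[OF D]) auto
  also note nn_integral_std_normal_tail[OF r]
  finally show ?thesis
    using r by simp
qed

lemma inner_abs_tail:
  assumes r: "r > 0" and a: "norm a \<le> c"
  shows "prob {\<omega> \<in> space M. c * \<sigma> * r < \<bar>a \<bullet> \<xi> \<omega>\<bar>} \<le> 2 * (exp (- r\<^sup>2 / 2) / (r * sqrt (2 * pi)))"
proof -
  have "{\<omega> \<in> space M. c * \<sigma> * r < \<bar>a \<bullet> \<xi> \<omega>\<bar>} =
      {\<omega> \<in> space M. c * \<sigma> * r < a \<bullet> \<xi> \<omega>} \<union> {\<omega> \<in> space M. c * \<sigma> * r < (- a) \<bullet> \<xi> \<omega>}"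
    by auto
  also have "prob \<dots> \<le> prob {\<omega> \<in> space M. c * \<sigma> * r < a \<bullet> \<xi> \<omega>} + prob {\<omega> \<in> space M. c * \<sigma> * r < (- a) \<bullet> \<xi> \<omega>}"
    by (rule measure_Un_le) measurable
  also have "\<dots> \<le> 2 * (exp (- r\<^sup>2 / 2) / (r * sqrt (2 * pi)))"
    by (rule order_trans[OF add_mono[OF inner_upper_tail[OF r] inner_upper_tail[OF r]]]) (use a in simp_all)
  finally show ?thesis .
qed

text \<open>At the level \<open>sqrt (2 ln p)\<close> the union bound is \<open>1 / sqrt (pi ln p)\<close>. As \<open>ln p \<ge> ln 2 \<ge> 2 / 3\<close> and \<open>pi \<ge> 3\<close>, this is
at most \<open>1 / sqrt 2\<close>, which is below 0.71.\<close>

lemma maximal_inequality: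
  fixes a :: "'j \<Rightarrow> real ^ 'n"
  assumes "finite J" "card J \<le> p" "2 \<le> p" and a: "\<And>j. j \<in> J \<Longrightarrow> norm (a j) \<le> c"
  shows "0.29 \<le> prob {\<omega> \<in> space M. \<forall>j\<in>J. \<bar>a j \<bullet> \<xi> \<omega>\<bar> \<le> c * \<sigma> * sqrt (2 * ln (real p))}"
proof -
  define r where "r = sqrt (2 * ln (real p))"
  have lnp: "2 / 3 \<le> ln (real p)"
  proof -
    have "ln 2 \<le> ln (real p)"
      using \<open>2 \<le> p\<close> by simp
    then show ?thesis
      using ln2_ge_two_thirds by linarith
  qed
  then have r: "0 < r" "r\<^sup>2 = 2 * ln (real p)" by (auto simp: r_def)
  define q where "q = 2 * (exp (- r\<^sup>2 / 2) / (r * sqrt (2 * pi)))"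
  have q0: "0 \<le> q" using r by (simp add: q_def)
  let ?bad = "\<lambda>j. {\<omega> \<in> space M. c * \<sigma> * r < \<bar>a j \<bullet> \<xi> \<omega>\<bar>}"
  have "prob (\<Union>j\<in>J. ?bad j) \<le> (\<Sum>j\<in>J. prob (?bad j))"
    by (rule finite_measure_subadditive_finite) (use \<open>finite J\<close> in auto)
  also have "\<dots> \<le> (\<Sum>j\<in>J. q)"
    unfolding q_def by (intro sum_mono inner_abs_tail r a)
  also have "\<dots> \<le> real p * q"
    using \<open>card J \<le> p\<close> q0 by (simp add: mult_right_mono)
  also have "\<dots> \<le> 0.71"
  proof -
    have "exp (- r\<^sup>2 / 2) = 1 / real p"
      unfolding r(2) using \<open>2 \<le> p\<close> by (simp add: exp_minus inverse_eq_divide)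
    then have "real p * q = 2 / (r * sqrt (2 * pi))"
      using \<open>2 \<le> p\<close> by (simp add: q_def)
    moreover have "r * sqrt (2 * pi) = sqrt (4 * (ln (real p) * pi))"
      by (simp add: r_def real_sqrt_mult[symmetric])
    moreover have "sqrt 8 \<le> \<dots>"
    proof (rule real_sqrt_le_mono)
      have "2 / 3 * 3 \<le> ln (real p) * pi"
        using lnp pi_gt3 by (intro mult_mono) auto
      then show "8 \<le> 4 * (ln (real p) * pi)" by linarith
    qed
    moreover have "2.82 \<le> sqrt (8::real)"
      by (rule real_le_rsqrt) (simp add: power2_eq_square)
    ultimately have "2.82 \<le> r * sqrt (2 * pi)" "real p * q = 2 / (r * sqrt (2 * pi))" by linarith+
    then show ?thesis
      using divide_left_mono[of "2.82" "r * sqrt (2 * pi)" "2::real"] r by simp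
  qed
  finally have "prob (\<Union>j\<in>J. ?bad j) \<le> 0.71" .
  moreover have "{\<omega> \<in> space M. \<forall>j\<in>J. \<bar>a j \<bullet> \<xi> \<omega>\<bar> \<le> c * \<sigma> * r} = space M - (\<Union>j\<in>J. ?bad j)"
    by (auto simp: not_less)
  moreover have "prob (space M - (\<Union>j\<in>J. ?bad j)) = 1 - prob (\<Union>j\<in>J. ?bad j)"
    using \<open>finite J\<close> by (intro prob_compl) auto
  ultimately show ?thesis
    unfolding r_def by simp
qed

end

section \<open>Orthogonal projections and suprema of affine functions\<close>

definition orthonormal :: "'b::euclidean_space set \<Rightarrow> bool" where
  "orthonormal B \<longleftrightarrow> pairwise orthogonal B \<and> (\<forall>v\<in>B. norm v = 1)"

definition proj :: "'b::euclidean_space set \<Rightarrow> 'b \<Rightarrow> 'b" where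
  "proj B y = (\<Sum>v\<in>B. (v \<bullet> y) *\<^sub>R v)"

lemma inner_residual_eq_0:
  assumes "orthonormal B" "x \<in> span B"
  shows "x \<bullet> (y - proj B y) = 0"
proof -
  have "(\<Sum>v\<in>B. (v \<bullet> y / (v \<bullet> v)) *\<^sub>R v) = proj B y"
    unfolding proj_def using assms(1) by (intro sum.cong) (auto simp: orthonormal_def norm_eq_1)
  then show ?thesis
    using Gram_Schmidt_step[of B x y] assms by (simp add: orthogonal_def orthonormal_def)
qed

lemma proj_in_span: "proj B y \<in> span B"
  unfolding proj_def by (intro span_sum span_scale span_base)

lemma norm_proj_squared:
  assumes "orthonormal B"
  shows "(norm (proj B y))\<^sup>2 = (\<Sum>v\<in>B. (v \<bullet> y)\<^sup>2)"
proof -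
  have "proj B y \<bullet> proj B y = proj B y \<bullet> y"
    using inner_residual_eq_0[OF assms proj_in_span, of y y] by (simp add: inner_diff_right)
  also have "\<dots> = (\<Sum>v\<in>B. (v \<bullet> y)\<^sup>2)"
    by (simp add: proj_def inner_sum_left power2_eq_square)
  finally show ?thesis by (simp add: power2_norm_eq_inner)
qed

lemma norm_residual_le:
  assumes "orthonormal B"
  shows "norm (y - proj B y) \<le> norm y"
proof -
  have "(norm y)\<^sup>2 = (norm (y - proj B y))\<^sup>2 + (norm (proj B y))\<^sup>2"
    using norm_add_Pythagorean[of "y - proj B y" "proj B y"]
      inner_residual_eq_0[OF assms proj_in_span, of y y]
    by (simp add: orthogonal_def inner_commute)
  then have "(norm (y - proj B y))\<^sup>2 \<le> (norm y)\<^sup>2"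
    by simp
  then show ?thesis
    by (rule power2_le_imp_le) simp
qed

lemma proj_diff: "proj B (x - y) = proj B x - proj B y"
  by (simp add: proj_def inner_diff_right scaleR_diff_left sum_subtractf)

lemma inner_residual_adjoint: "x \<bullet> (y - proj B y) = (x - proj B x) \<bullet> y"
  by (simp add: proj_def inner_diff_left inner_diff_right inner_sum_left inner_sum_right inner_commute mult.commute)

lemma borel_measurable_proj [measurable]: "proj B \<in> borel_measurable borel"
  by (simp add: proj_def[abs_def])

lemma orthonormal_basis_exists:
  obtains B where "orthonormal B" "card B = dim A" "span B = span (A :: 'b::euclidean_space set)"
  using orthonormal_basis_subspace[OF subspace_span, of A]
  unfolding orthonormal_def by (metis dim_span)

lemma lipschitz_on_SUP_affine:
  fixes a :: "'u \<Rightarrow> 'b::real_inner" and c :: "'u \<Rightarrow> real"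
  assumes "U \<noteq> {}" and a: "\<And>u. u \<in> U \<Longrightarrow> norm (a u) \<le> 1" and c: "\<And>u. u \<in> U \<Longrightarrow> c u \<le> C"
  shows "1-lipschitz_on UNIV (\<lambda>x. SUP u\<in>U. a u \<bullet> x + c u)"
proof -
  have inner_le: "a u \<bullet> x \<le> norm x" if "u \<in> U" for u x
    using norm_cauchy_schwarz[of "a u" x] mult_right_mono[OF a[OF that], of "norm x"] by simp
  have bdd: "bdd_above ((\<lambda>u. a u \<bullet> x + c u) ` U)" for x
    using add_mono[OF inner_le c] by (intro bdd_aboveI2) blast
  have "(SUP u\<in>U. a u \<bullet> x + c u) \<le> (SUP u\<in>U. a u \<bullet> y + c u) + dist x y" for x y
  proof (rule cSUP_least[OF \<open>U \<noteq> {}\<close>])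
    fix u assume u: "u \<in> U"
    have "a u \<bullet> x + c u = (a u \<bullet> y + c u) + a u \<bullet> (x - y)"
      by (simp add: inner_diff_right)
    also have "\<dots> \<le> (SUP u\<in>U. a u \<bullet> y + c u) + dist x y"
      unfolding dist_norm by (intro add_mono inner_le u cSUP_upper bdd)
    finally show "a u \<bullet> x + c u \<le> (SUP u\<in>U. a u \<bullet> y + c u) + dist x y" .
  qed
  note le = this
  show ?thesis
  proof (rule lipschitz_onI)
    fix x y :: 'b
    show "dist (SUP u\<in>U. a u \<bullet> x + c u) (SUP u\<in>U. a u \<bullet> y + c u) \<le> 1 * dist x y"
      using le[of x y] le[of y x] by (simp add: dist_real_def dist_commute abs_le_iff)
  qed simp
qed

section \<open>Deviations split along a subspace\<close>

context gaussian_vector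
begin

text \<open>Two applications of concentration. The lower tail of the function \<open>G (y - proj B y)\<close>, which is again 1-Lipschitz, bounds
its mean by \<open>K + 2.8 \<sigma>\<close>, because \<open>exp (- 2.8\<^sup>2 / 2)\<close> is below the probability of being at most \<open>K\<close>. The mean of \<open>G\<close> exceeds
this by at most the mean of the norm of the projected noise, and the upper tail of \<open>G\<close> does the rest.\<close>

theorem lipschitz_deviation_modulo_projection:
  fixes G :: "real ^ 'n \<Rightarrow> real"
  assumes lip: "1-lipschitz_on UNIV G" and B: "orthonormal B"
    and K: "0 \<le> K" "0.29 \<le> prob {\<omega> \<in> space M. G (\<xi> \<omega> - proj B (\<xi> \<omega>)) \<le> K}"
    and \<delta>: "0 < \<delta>" "\<delta> < 1"
  shows "1 - \<delta> \<le> prob {\<omega> \<in> space M. G (\<xi> \<omega>) \<le> K + \<sigma> * (sqrt (real (card B)) + sqrt (2 * ln (1 / \<delta>)) + 2.8)}"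
proof -
  let ?P = "proj B"
  define r where "r = sqrt (2 * ln (1 / \<delta>))"
  have r: "0 \<le> r" "exp (- r\<^sup>2 / 2) = \<delta>"
    using \<delta> by (auto simp: r_def ln_div)
  define T where "T = K + \<sigma> * (sqrt (real (card B)) + r + 2.8)"
  have T: "0 \<le> T" "K \<le> T"
    using K r sigma_pos by (auto simp: T_def)
  \<comment> \<open>Clamping makes the function bounded, so that the tail bounds apply, and at a level above \<open>T\<close> it does not
    alter the event \<open>G \<le> T\<close>.\<close>
  define C where "C x = max (- (T + 1)) (min (T + 1) (G x))" for x
  have C_lip: "1-lipschitz_on UNIV C"
  proof (rule lipschitz_onI)
    fix x y
    have "\<bar>G x - G y\<bar> \<le> dist x y"
      using lipschitz_onD[OF lip, of x y] by (simp add: dist_real_def)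
    then show "dist (C x) (C y) \<le> 1 * dist x y"
      unfolding C_def dist_real_def by (simp add: max_def min_def abs_le_iff)
  qed simp
  have C_bnd: "\<bar>C x\<bar> \<le> T + 1" for x
    using T by (auto simp: C_def abs_le_iff)
  have [measurable]: "C \<in> borel_measurable borel" "G \<in> borel_measurable borel"
    by (intro borel_measurable_continuous_onI lipschitz_on_continuous_on[OF C_lip] lipschitz_on_continuous_on[OF lip])+
  have CP_lip: "1-lipschitz_on UNIV (\<lambda>x. C (x - ?P x))"
  proof (rule lipschitz_onI)
    fix x y
    have "dist (C (x - ?P x)) (C (y - ?P y)) \<le> norm ((x - y) - ?P (x - y))"
      using lipschitz_onD[OF C_lip, of "x - ?P x" "y - ?P y"]
      by (simp add: dist_norm proj_diff algebra_simps)
    also have "\<dots> \<le> dist x y"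
      using norm_residual_le[OF B, of "x - y"] by (simp add: dist_norm)
    finally show "dist (C (x - ?P x)) (C (y - ?P y)) \<le> 1 * dist x y" by simp
  qed simp
  have [measurable]: "(\<lambda>x. C (x - ?P x)) \<in> borel_measurable borel"
    by (intro borel_measurable_continuous_onI lipschitz_on_continuous_on[OF CP_lip])
  define E1 where "E1 = expectation (\<lambda>\<omega>. C (\<xi> \<omega> - ?P (\<xi> \<omega>)))"
  have E1: "E1 \<le> K + \<sigma> * 2.8"
  proof (rule ccontr)
    assume "\<not> E1 \<le> K + \<sigma> * 2.8"
    then have "{\<omega> \<in> space M. G (\<xi> \<omega> - ?P (\<xi> \<omega>)) \<le> K} \<subseteq> {\<omega> \<in> space M. C (\<xi> \<omega> - ?P (\<xi> \<omega>)) \<le> E1 - 1 * \<sigma> * 2.8}"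
      using T K by (auto simp: C_def)
    then have "prob {\<omega> \<in> space M. G (\<xi> \<omega> - ?P (\<xi> \<omega>)) \<le> K} \<le> prob {\<omega> \<in> space M. C (\<xi> \<omega> - ?P (\<xi> \<omega>)) \<le> E1 - 1 * \<sigma> * 2.8}"
      by (intro finite_measure_mono) measurable
    also have "\<dots> \<le> exp (- (2.8)\<^sup>2 / 2)"
      unfolding E1_def by (rule lipschitz_lower_tail[OF CP_lip C_bnd]) auto
    also have "\<dots> < 0.29"
    proof -
      have "4 \<le> exp ((2.8)\<^sup>2 / 2 :: real)"
        using exp_ge_add_one_self[of "(2.8)\<^sup>2 / 2 :: real"] by (simp add: power2_eq_square)
      then have "inverse (exp ((2.8)\<^sup>2 / 2 :: real)) \<le> inverse 4"
        by (intro le_imp_inverse_le) auto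
      then show ?thesis by (simp add: exp_minus)
    qed
    finally show False
      using K(2) by simp
  qed
  have intP2: "integrable M (\<lambda>\<omega>. (norm (?P (\<xi> \<omega>)))\<^sup>2)"
    and EP2: "expectation (\<lambda>\<omega>. (norm (?P (\<xi> \<omega>)))\<^sup>2) = real (card B) * \<sigma>\<^sup>2"
    unfolding norm_proj_squared[OF B] using B by (simp_all add: integrable_inner_square expectation_inner_square orthonormal_def)
  have intP: "integrable M (\<lambda>\<omega>. norm (?P (\<xi> \<omega>)))"
    by (rule square_integrable_imp_integrable[OF _ intP2]) measurable
  have EP: "expectation (\<lambda>\<omega>. norm (?P (\<xi> \<omega>))) \<le> \<sigma> * sqrt (real (card B))"
  proof -
    have "(expectation (\<lambda>\<omega>. norm (?P (\<xi> \<omega>))))\<^sup>2 \<le> real (card B) * \<sigma>\<^sup>2"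
      using variance_positive[of "\<lambda>\<omega>. norm (?P (\<xi> \<omega>))"] variance_eq[OF intP intP2] EP2 by simp
    then have "expectation (\<lambda>\<omega>. norm (?P (\<xi> \<omega>))) \<le> sqrt (real (card B) * \<sigma>\<^sup>2)"
      by (rule real_le_rsqrt)
    then show ?thesis
      using sigma_pos by (simp add: real_sqrt_mult mult.commute)
  qed
  define E0 where "E0 = expectation (\<lambda>\<omega>. C (\<xi> \<omega>))"
  have intC: "integrable M (\<lambda>\<omega>. C (\<xi> \<omega>))" "integrable M (\<lambda>\<omega>. C (\<xi> \<omega> - ?P (\<xi> \<omega>)))"
    by (rule integrable_const_bound[of _ "T + 1"]; use C_bnd in simp)+
  have "E0 \<le> expectation (\<lambda>\<omega>. C (\<xi> \<omega> - ?P (\<xi> \<omega>)) + norm (?P (\<xi> \<omega>)))"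
    unfolding E0_def
  proof (rule integral_mono)
    fix \<omega>
    show "C (\<xi> \<omega>) \<le> C (\<xi> \<omega> - ?P (\<xi> \<omega>)) + norm (?P (\<xi> \<omega>))"
      using lipschitz_onD[OF C_lip, of "\<xi> \<omega>" "\<xi> \<omega> - ?P (\<xi> \<omega>)"] by (simp add: dist_norm)
  qed (use intC intP in auto)
  also have "\<dots> = E1 + expectation (\<lambda>\<omega>. norm (?P (\<xi> \<omega>)))"
    unfolding E1_def using intC intP by (intro Bochner_Integration.integral_add) auto
  also have "\<dots> \<le> K + \<sigma> * 2.8 + \<sigma> * sqrt (real (card B))"
    using E1 EP by simp
  finally have E0: "E0 + 1 * \<sigma> * r \<le> T"
    by (simp add: T_def algebra_simps)
  have "prob {\<omega> \<in> space M. E0 + 1 * \<sigma> * r \<le> C (\<xi> \<omega>)} \<le> \<delta>"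
    using lipschitz_upper_tail[OF C_lip C_bnd _ r(1)] r(2) unfolding E0_def by simp
  then have "1 - \<delta> \<le> prob (space M - {\<omega> \<in> space M. E0 + 1 * \<sigma> * r \<le> C (\<xi> \<omega>)})"
    by (subst prob_compl) auto
  also have "\<dots> \<le> prob {\<omega> \<in> space M. G (\<xi> \<omega>) \<le> T}"
    using E0 by (intro finite_measure_mono) (auto simp: C_def)
  finally show ?thesis
    unfolding T_def r_def .
qed

end

section \<open>Optimality of the Lasso\<close>

lemma emp_norm_eq: "emp_norm (u :: real ^ 'n) = norm u / sqrt (real CARD('n))"
  by (simp add: emp_norm_def norm_vec_def L2_set_def real_sqrt_divide)

lemma le_of_le_add_small:
  fixes a c d :: real
  assumes "\<And>t. 0 < t \<Longrightarrow> t \<le> 1 \<Longrightarrow> a \<le> c + t * d"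
  shows "a \<le> c"
proof -
  have lim: "((\<lambda>t. c + t * d) \<longlongrightarrow> c + 0 * d) (at_right 0)"
    by (intro tendsto_intros)
  have "eventually (\<lambda>t::real. t \<in> {0<..<1}) (at_right 0)"
    by (intro eventually_at_rightI) auto
  then have "eventually (\<lambda>t. a \<le> c + t * d) (at_right 0)"
    by eventually_elim (use assms in auto)
  then show ?thesis
    using tendsto_lowerbound[OF lim] by simp
qed

lemma l1_norm_convex:
  assumes "0 \<le> t" "t \<le> 1"
  shows "l1_norm (b + t *\<^sub>R (b' - b)) \<le> (1 - t) * l1_norm b + t * l1_norm b'"
proof -
  have "l1_norm (b + t *\<^sub>R (b' - b)) \<le> (\<Sum>j\<in>UNIV. (1 - t) * \<bar>b $ j\<bar> + t * \<bar>b' $ j\<bar>)"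
    unfolding l1_norm_def
  proof (rule sum_mono)
    fix j
    have "(b + t *\<^sub>R (b' - b)) $ j = (1 - t) * b $ j + t * b' $ j"
      by (simp add: algebra_simps)
    then show "\<bar>(b + t *\<^sub>R (b' - b)) $ j\<bar> \<le> (1 - t) * \<bar>b $ j\<bar> + t * \<bar>b' $ j\<bar>"
      using abs_triangle_ineq[of "(1 - t) * b $ j" "t * b' $ j"] assms by (simp add: abs_mult)
  qed
  then show ?thesis
    by (simp add: l1_norm_def sum.distrib sum_distrib_left)
qed

text \<open>First-order optimality along the segment from \<open>b\<close> to \<open>b'\<close>. The penalty is only convex, so it is bounded by its
chord while the quadratic part is expanded, and the step length tends to 0.\<close>

lemma lasso_variational_inequality:
  fixes X :: "real ^ 'p ^ 'n"
  assumes lasso: "is_lasso X y lam b" and lam: "0 \<le> lam"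
  shows "(y - X *v b) \<bullet> (X *v b' - X *v b) \<le> real CARD('n) * lam * (l1_norm b' - l1_norm b)"
proof -
  let ?n = "real CARD('n)"
  define d where "d = X *v b' - X *v b"
  have obj: "(norm (X *v b - y))\<^sup>2 + 2 * ?n * lam * l1_norm b \<le> (norm (X *v c - y))\<^sup>2 + 2 * ?n * lam * l1_norm c" for c
  proof -
    have "(norm (X *v b - y))\<^sup>2 / ?n + 2 * lam * l1_norm b \<le> (norm (X *v c - y))\<^sup>2 / ?n + 2 * lam * l1_norm c"
      using lasso unfolding is_lasso_def is_arg_min_linorder emp_norm_eq by (simp add: power_divide)
    then have "?n * ((norm (X *v b - y))\<^sup>2 / ?n + 2 * lam * l1_norm b) \<le> ?n * ((norm (X *v c - y))\<^sup>2 / ?n + 2 * lam * l1_norm c)"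
      by (intro mult_left_mono) auto
    then show ?thesis by (simp add: distrib_left mult_ac)
  qed
  have square: "(norm (a + t *\<^sub>R d))\<^sup>2 = (norm a)\<^sup>2 + 2 * t * (a \<bullet> d) + t\<^sup>2 * (norm d)\<^sup>2" for a t
    unfolding power2_norm_eq_inner
    by (simp add: inner_add_left inner_add_right inner_commute[of d a] power2_eq_square algebra_simps)
  show ?thesis
    unfolding d_def[symmetric]
  proof (rule le_of_le_add_small)
    fix t :: real assume t: "0 < t" "t \<le> 1"
    have "X *v (b + t *\<^sub>R (b' - b)) - y = (X *v b - y) + t *\<^sub>R d"
      by (simp add: d_def matrix_vector_right_distrib matrix_vector_mult_diff_distrib matrix_vector_mult_scaleR)
    then have "(norm (X *v (b + t *\<^sub>R (b' - b)) - y))\<^sup>2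
        = (norm (X *v b - y))\<^sup>2 + 2 * t * ((X *v b - y) \<bullet> d) + t\<^sup>2 * (norm d)\<^sup>2"
      by (simp only: square)
    moreover have "2 * ?n * lam * l1_norm (b + t *\<^sub>R (b' - b)) \<le> 2 * ?n * lam * ((1 - t) * l1_norm b + t * l1_norm b')"
      using l1_norm_convex[of t b b'] t lam by (intro mult_left_mono) auto
    ultimately have "0 \<le> 2 * t * ((X *v b - y) \<bullet> d) + t\<^sup>2 * (norm d)\<^sup>2 + 2 * ?n * lam * (t * (l1_norm b' - l1_norm b))"
      using obj[of "b + t *\<^sub>R (b' - b)"] by (simp add: algebra_simps)
    also have "\<dots> = 2 * t * (?n * lam * (l1_norm b' - l1_norm b) + t * ((norm d)\<^sup>2 / 2) - (y - X *v b) \<bullet> d)"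
      by (simp add: algebra_simps power2_eq_square inner_diff_left)
    finally show "(y - X *v b) \<bullet> d \<le> ?n * lam * (l1_norm b' - l1_norm b) + t * ((norm d)\<^sup>2 / 2)"
      using t by (simp add: zero_le_mult_iff)
  qed
qed

text \<open>Add the variational inequalities of both minimizers, each tested against the other: the penalties cancel.\<close>

lemma lasso_fit_nonexpansive:
  fixes X :: "real ^ 'p ^ 'n"
  assumes "is_lasso X y lam b" "is_lasso X y' lam b'" "0 \<le> lam"
  shows "dist (X *v b) (X *v b') \<le> dist y y'"
proof -
  define d where "d = X *v b - X *v b'"
  have "(y - X *v b) \<bullet> (X *v b' - X *v b) + (y' - X *v b') \<bullet> (X *v b - X *v b') \<le> 0"
    using lasso_variational_inequality[OF assms(1,3), of b'] lasso_variational_inequality[OF assms(2,3), of b]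
    by (simp add: algebra_simps)
  then have "d \<bullet> d \<le> (y - y') \<bullet> d"
    unfolding d_def by (simp add: inner_diff_left inner_diff_right algebra_simps)
  also have "\<dots> \<le> norm (y - y') * norm d"
    by (rule norm_cauchy_schwarz)
  finally have "norm d * norm d \<le> norm (y - y') * norm d"
    by (simp add: power2_norm_eq_inner[symmetric] power2_eq_square)
  then show ?thesis
    unfolding d_def dist_norm by (cases "X *v b - X *v b' = 0") (auto dest: mult_right_le_imp_le)
qed

text \<open>The variational inequality contributes the term \<open>- |X (b - \<beta>)|\<^sup>2\<close>. Comparing the values of the objective at
\<open>b\<close> and \<open>\<beta>\<close> would give the inequality without it; that term is what allows the constant 1 in front of the
approximation error.\<close>

lemma lasso_basic_inequality:
  fixes X :: "real ^ 'p ^ 'n"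
  assumes "is_lasso X (f + z) lam b" "0 \<le> lam"
  shows "(norm (X *v b - f))\<^sup>2 \<le> (norm (X *v \<beta> - f))\<^sup>2 +
    2 * (z \<bullet> (X *v (b - \<beta>)) + real CARD('n) * lam * (l1_norm \<beta> - l1_norm b)) - (norm (X *v (b - \<beta>)))\<^sup>2"
  using lasso_variational_inequality[OF assms, of \<beta>]
  by (simp add: matrix_vector_mult_diff_distrib power2_norm_eq_inner inner_diff_left inner_diff_right
      inner_add_left inner_commute algebra_simps)

text \<open>The minimizer need not be unique, so \<open>\<beta>hat\<close> may be any function of the sample point. Its image under \<open>X\<close> depends
on the noise alone, through a function that is 1-Lipschitz on the range of the noise.\<close>

theorem lasso_fit_measurable:
  fixes X :: "real ^ 'p ^ 'n" and \<xi> :: "'a \<Rightarrow> real ^ 'n"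
  assumes [measurable]: "\<xi> \<in> borel_measurable M" and lam: "0 \<le> lam"
    and lasso: "\<And>\<omega>. \<omega> \<in> space M \<Longrightarrow> is_lasso X (f + \<xi> \<omega>) lam (\<beta>hat \<omega>)"
  shows "(\<lambda>\<omega>. X *v \<beta>hat \<omega>) \<in> borel_measurable M"
proof -
  \<comment> \<open>Any sample point with noise \<open>z\<close> serves, as they all give the same fit.\<close>
  define h where "h z = X *v \<beta>hat (inv_into (space M) \<xi> z)" for z
  have inv: "inv_into (space M) \<xi> z \<in> space M" "\<xi> (inv_into (space M) \<xi> z) = z" if "z \<in> \<xi> ` space M" for z
    using that by (auto intro: inv_into_into f_inv_into_f)
  have dist_le: "dist (X *v \<beta>hat \<omega>) (X *v \<beta>hat \<omega>') \<le> dist (\<xi> \<omega>) (\<xi> \<omega>')"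
    if "\<omega> \<in> space M" "\<omega>' \<in> space M" for \<omega> \<omega>'
    using lasso_fit_nonexpansive[OF lasso[OF that(1)] lasso[OF that(2)] lam] by (simp add: dist_norm)
  have "1-lipschitz_on (\<xi> ` space M) h"
  proof (rule lipschitz_onI)
    fix y z assume "y \<in> \<xi> ` space M" "z \<in> \<xi> ` space M"
    then show "dist (h y) (h z) \<le> 1 * dist y z"
      using dist_le[OF inv(1)[of y] inv(1)[of z]] inv(2) by (simp add: h_def)
  qed simp
  then have "continuous_on (\<xi> ` space M) h"
    by (rule lipschitz_on_continuous_on)
  then have "h \<in> borel_measurable (restrict_space borel (\<xi> ` space M))"
    by (rule borel_measurable_continuous_on_restrict)
  moreover have "\<xi> \<in> measurable M (restrict_space borel (\<xi> ` space M))"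
    by (rule measurable_restrict_space2) auto
  ultimately have "(\<lambda>\<omega>. h (\<xi> \<omega>)) \<in> borel_measurable M"
    by (rule measurable_compose[rotated])
  moreover have "h (\<xi> \<omega>) = X *v \<beta>hat \<omega>" if "\<omega> \<in> space M" for \<omega>
  proof -
    have "\<xi> \<omega> \<in> \<xi> ` space M" using that by simp
    from dist_le[OF inv(1)[OF this] that] inv(2)[OF this] show ?thesis
      by (simp add: h_def)
  qed
  ultimately show ?thesis
    by (simp cong: measurable_cong)
qed

section \<open>Sparsity and restricted eigenvalues\<close>

lemma length_abs_decreasing: "length (abs_decreasing (d :: real ^ 'p)) = CARD('p)"
  by (simp add: abs_decreasing_def flip: size_mset)

lemma mset_abs_decreasing: "mset (abs_decreasing d) = image_mset (\<lambda>j. \<bar>d $ j\<bar>) (mset_set UNIV)"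
  by (simp add: abs_decreasing_def)

lemma abs_decreasing_antimono:
  assumes "i \<le> k" "k < length (abs_decreasing d)"
  shows "abs_decreasing d ! k \<le> abs_decreasing d ! i"
  using assms unfolding abs_decreasing_def by (auto simp: rev_nth intro!: sorted_nth_mono)

text \<open>Let \<open>\<tau>\<close> be the \<open>s\<close>-th largest absolute value. Replacing each term by \<open>\<tau>\<close> plus its excess over \<open>\<tau>\<close> and then summing the
excesses over all coordinates gives a bound that depends only on the multiset of the absolute values, so it can be
evaluated along the sorted list, where precisely the first \<open>s\<close> entries contribute.\<close>

lemma sum_abs_le_sum_abs_decreasing:
  fixes d :: "real ^ 'p"
  assumes S: "card S \<le> s" and s: "1 \<le> s" "s \<le> CARD('p)"
  shows "(\<Sum>j\<in>S. \<bar>d $ j\<bar>) \<le> (\<Sum>k=1..s. abs_decreasing d ! (k - 1))"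
proof -
  let ?L = "abs_decreasing d"
  define \<tau> where "\<tau> = ?L ! (s - 1)"
  define \<phi> where "\<phi> x = max (x - \<tau>) 0" for x :: real
  have len: "length ?L = CARD('p)" by (rule length_abs_decreasing)
  have "\<tau> \<in># mset ?L"
    unfolding \<tau>_def set_mset_mset by (rule nth_mem) (use s len in auto)
  then have \<tau>: "0 \<le> \<tau>"
    unfolding mset_abs_decreasing by auto
  have "(\<Sum>j\<in>S. \<bar>d $ j\<bar>) \<le> (\<Sum>j\<in>S. \<tau> + \<phi> \<bar>d $ j\<bar>)"
    by (intro sum_mono) (simp add: \<phi>_def)
  also have "\<dots> = real (card S) * \<tau> + (\<Sum>j\<in>S. \<phi> \<bar>d $ j\<bar>)"
    by (simp add: sum.distrib)
  also have "\<dots> \<le> real s * \<tau> + (\<Sum>j\<in>UNIV. \<phi> \<bar>d $ j\<bar>)"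
    using S \<tau> by (intro add_mono mult_right_mono sum_mono2) (auto simp: \<phi>_def)
  also have "(\<Sum>j\<in>UNIV. \<phi> \<bar>d $ j\<bar>) = sum_mset (image_mset \<phi> (mset ?L))"
    unfolding mset_abs_decreasing by (simp add: sum_unfold_sum_mset image_mset.compositionality comp_def)
  also have "\<dots> = (\<Sum>k<CARD('p). \<phi> (?L ! k))"
    by (simp add: sum_list_sum_nth len atLeast0LessThan sum_mset_sum_list del: mset_map flip: mset_map)
  also have "\<dots> = (\<Sum>k<s. \<phi> (?L ! k))"
  proof (rule sum.mono_neutral_right)
    show "\<forall>k\<in>{..<CARD('p)} - {..<s}. \<phi> (?L ! k) = 0"
      using abs_decreasing_antimono[of "s - 1" _ d] by (auto simp: \<phi>_def \<tau>_def len max_def)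
  qed (use s in auto)
  also have "\<dots> = (\<Sum>k<s. ?L ! k - \<tau>)"
  proof (rule sum.cong)
    fix k assume "k \<in> {..<s}"
    then have "\<tau> \<le> ?L ! k"
      unfolding \<tau>_def using s by (intro abs_decreasing_antimono) (auto simp: len)
    then show "\<phi> (?L ! k) = ?L ! k - \<tau>" by (simp add: \<phi>_def)
  qed simp
  also have "real s * \<tau> + \<dots> = (\<Sum>k<s. ?L ! k)"
    by (simp add: sum_subtractf)
  also have "\<dots> = (\<Sum>k=1..s. ?L ! (k - 1))"
    by (rule sum.reindex_bij_witness[of _ "\<lambda>k. k - 1" Suc]) auto
  finally show ?thesis .
qed

lemma l1_norm_split: "l1_norm (u :: real ^ 'p) = (\<Sum>j\<in>S. \<bar>u $ j\<bar>) + (\<Sum>j\<in>-S. \<bar>u $ j\<bar>)"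
  unfolding l1_norm_def by (subst sum.union_disjoint[symmetric]) (auto simp: Compl_eq_Diff_UNIV)

lemma RE_coneI:
  fixes u :: "real ^ 'p"
  assumes "card S \<le> s" "1 \<le> s" "s \<le> CARD('p)" "0 \<le> c0"
    and "(\<Sum>j\<in>-S. \<bar>u $ j\<bar>) \<le> c0 * (\<Sum>j\<in>S. \<bar>u $ j\<bar>)"
  shows "u \<in> RE_cone s c0"
proof -
  have "l1_norm u \<le> (1 + c0) * (\<Sum>j\<in>S. \<bar>u $ j\<bar>)"
    using assms(5) by (simp add: l1_norm_split[of u S] algebra_simps)
  also have "\<dots> \<le> (1 + c0) * (\<Sum>j=1..s. abs_decreasing u ! (j - 1))"
    using assms by (intro mult_left_mono sum_abs_le_sum_abs_decreasing) auto
  finally show ?thesis by (simp add: RE_cone_def)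
qed

lemma axis_in_RE_cone:
  assumes "1 \<le> s" "s \<le> CARD('p)" "0 \<le> c0"
  shows "(axis j 1 :: real ^ 'p) \<in> RE_cone s c0"
  using assms by (intro RE_coneI[of "{j}"]) (auto simp: axis_def)

lemma RE_const_le:
  assumes "u \<in> RE_cone s c0" "u \<noteq> 0"
  shows "RE_const X s c0 * norm u \<le> emp_norm (X *v u)"
proof -
  have "RE_const X s c0 \<le> emp_norm (X *v u) / norm u"
    unfolding RE_const_def using assms
    by (intro cINF_lower bdd_belowI2[of _ 0]) (auto simp: emp_norm_eq)
  then show ?thesis
    using assms by (simp add: pos_le_divide_eq)
qed

lemma RE_const_nonneg:
  fixes X :: "real ^ 'p ^ 'n"
  assumes "1 \<le> s" "s \<le> CARD('p)" "0 \<le> c0"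
  shows "0 \<le> RE_const X s c0"
proof -
  have "axis undefined 1 \<in> {d :: real ^ 'p. d \<in> RE_cone s c0 \<and> d \<noteq> 0}"
    using axis_in_RE_cone[OF assms] by (simp add: axis_eq_0_iff)
  then show ?thesis
    unfolding RE_const_def by (intro cINF_greatest) (auto simp: emp_norm_eq)
qed

lemma sum_abs_le_sqrt_card_norm:
  fixes u :: "real ^ 'p"
  assumes "card S \<le> s"
  shows "(\<Sum>j\<in>S. \<bar>u $ j\<bar>) \<le> sqrt (real s) * norm u"
proof -
  have "(\<Sum>j\<in>S. \<bar>u $ j\<bar>) = (\<Sum>j\<in>S. \<bar>u $ j\<bar> * \<bar>1\<bar>)"
    by simp
  also have "\<dots> \<le> L2_set (\<lambda>j. u $ j) S * L2_set (\<lambda>_. 1) S"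
    by (rule L2_set_mult_ineq)
  also have "\<dots> \<le> norm u * sqrt (real s)"
  proof (rule mult_mono)
    show "L2_set (\<lambda>j. u $ j) S \<le> norm u"
      unfolding norm_vec_def L2_set_def by (simp add: sum_mono2)
    show "L2_set (\<lambda>_. 1) S \<le> sqrt (real s)"
      using assms by (simp add: L2_set_def)
  qed auto
  finally show ?thesis by (simp add: mult.commute)
qed

text \<open>If the left-hand side is positive then \<open>u\<close> lies in the cone with constant \<open>1 + 1 / \<epsilon>\<close>, as \<open>(1 + \<epsilon>) / \<epsilon> = 1 + 1 / \<epsilon>\<close>; there
the sum over \<open>S\<close> is controlled by the Euclidean norm and hence by \<open>X u\<close>.\<close>

lemma restricted_eigenvalue_penalty_bound:
  fixes X :: "real ^ 'p ^ 'n" and u :: "real ^ 'p"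
  assumes S: "card S \<le> s" "1 \<le> s" "s \<le> CARD('p)" and \<epsilon>: "0 < \<epsilon>"
    and \<kappa>: "0 < RE_const X s (1 + 1 / \<epsilon>)"
  shows "(\<Sum>j\<in>S. \<bar>u $ j\<bar>) - \<epsilon> / (1 + \<epsilon>) * (\<Sum>j\<in>-S. \<bar>u $ j\<bar>)
    \<le> sqrt (real s) * emp_norm (X *v u) / RE_const X s (1 + 1 / \<epsilon>)"
proof (cases "(\<Sum>j\<in>-S. \<bar>u $ j\<bar>) \<le> (1 + 1 / \<epsilon>) * (\<Sum>j\<in>S. \<bar>u $ j\<bar>)")
  case True
  have "norm u \<le> emp_norm (X *v u) / RE_const X s (1 + 1 / \<epsilon>)"
  proof (cases "u = 0")
    case False
    have "u \<in> RE_cone s (1 + 1 / \<epsilon>)"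
      using S \<epsilon> True by (intro RE_coneI) auto
    from RE_const_le[OF this False, of X] show ?thesis
      using \<kappa> by (simp add: pos_le_divide_eq mult.commute)
  qed (simp add: emp_norm_eq)
  then have "sqrt (real s) * norm u \<le> sqrt (real s) * (emp_norm (X *v u) / RE_const X s (1 + 1 / \<epsilon>))"
    by (intro mult_left_mono) auto
  moreover have "0 \<le> \<epsilon> / (1 + \<epsilon>) * (\<Sum>j\<in>-S. \<bar>u $ j\<bar>)"
    using \<epsilon> by (intro mult_nonneg_nonneg sum_nonneg) auto
  ultimately show ?thesis
    using sum_abs_le_sqrt_card_norm[OF S(1), of u] by simp
next
  case False
  then have "\<epsilon> / (1 + \<epsilon>) * ((1 + 1 / \<epsilon>) * (\<Sum>j\<in>S. \<bar>u $ j\<bar>)) \<le> \<epsilon> / (1 + \<epsilon>) * (\<Sum>j\<in>-S. \<bar>u $ j\<bar>)"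
    using \<epsilon> by (intro mult_left_mono) auto
  moreover have "\<epsilon> / (1 + \<epsilon>) * (1 + 1 / \<epsilon>) = 1"
    using \<epsilon> by (simp add: divide_simps)
  ultimately have "(\<Sum>j\<in>S. \<bar>u $ j\<bar>) \<le> \<epsilon> / (1 + \<epsilon>) * (\<Sum>j\<in>-S. \<bar>u $ j\<bar>)"
    by (simp only: mult.assoc[symmetric] mult_1)
  moreover have "0 \<le> sqrt (real s) * emp_norm (X *v u) / RE_const X s (1 + 1 / \<epsilon>)"
    using \<kappa> by (simp add: emp_norm_eq)
  ultimately show ?thesis by linarith
qed

lemma l1_norm_diff_le:
  fixes \<beta> u :: "real ^ 'p"
  assumes "{j. \<beta> $ j \<noteq> 0} \<subseteq> S"
  shows "l1_norm \<beta> - l1_norm (\<beta> + u) \<le> (\<Sum>j\<in>S. \<bar>u $ j\<bar>) - (\<Sum>j\<in>-S. \<bar>u $ j\<bar>)"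
proof -
  have "(\<Sum>j\<in>-S. \<bar>\<beta> $ j\<bar>) = 0" "(\<Sum>j\<in>-S. \<bar>(\<beta> + u) $ j\<bar>) = (\<Sum>j\<in>-S. \<bar>u $ j\<bar>)"
  proof -
    have "\<beta> $ j = 0" if "j \<notin> S" for j
      using assms that by blast
    then show "(\<Sum>j\<in>-S. \<bar>\<beta> $ j\<bar>) = 0" "(\<Sum>j\<in>-S. \<bar>(\<beta> + u) $ j\<bar>) = (\<Sum>j\<in>-S. \<bar>u $ j\<bar>)"
      by (auto intro!: sum.neutral sum.cong)
  qed
  moreover have "(\<Sum>j\<in>S. \<bar>\<beta> $ j\<bar>) \<le> (\<Sum>j\<in>S. \<bar>(\<beta> + u) $ j\<bar> + \<bar>u $ j\<bar>)"
    by (intro sum_mono) simp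
  ultimately show ?thesis
    by (simp add: l1_norm_split[of \<beta> S] l1_norm_split[of "\<beta> + u" S] sum.distrib)
qed

text \<open>The fits of \<open>s\<close>-sparse vectors form a finite union of subspaces, one for each admissible support, hence a closed set.\<close>

lemma sparse_least_squares_attained:
  fixes X :: "real ^ 'p ^ 'n" and f :: "real ^ 'n"
  obtains \<beta> where "l0_norm \<beta> \<le> s" "(INF b\<in>{b. l0_norm b \<le> s}. (emp_norm (X *v b - f))\<^sup>2) = (emp_norm (X *v \<beta> - f))\<^sup>2"
proof -
  define W where "W S = {b :: real ^ 'p. \<forall>j\<in>-S. b $ j = 0}" for S
  have sub: "subspace ((*v) X ` W S)" for S
    by (rule linear_subspace_image) (auto simp: W_def subspace_def)
  have eq: "(*v) X ` {b :: real ^ 'p. l0_norm b \<le> s} = (\<Union>S\<in>{S. card S \<le> s}. (*v) X ` W S)"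
  proof -
    have "{b :: real ^ 'p. l0_norm b \<le> s} = (\<Union>S\<in>{S. card S \<le> s}. W S)"
    proof (intro equalityI subsetI)
      fix b :: "real ^ 'p" assume "b \<in> {b. l0_norm b \<le> s}"
      then have "b \<in> W {j. b $ j \<noteq> 0}" "card {j. b $ j \<noteq> 0} \<le> s"
        by (auto simp: W_def l0_norm_def)
      then show "b \<in> (\<Union>S\<in>{S. card S \<le> s}. W S)" by blast
    next
      fix b :: "real ^ 'p" assume "b \<in> (\<Union>S\<in>{S. card S \<le> s}. W S)"
      then obtain S where S: "card S \<le> s" "{j. b $ j \<noteq> 0} \<subseteq> S"
        by (auto simp: W_def)
      then show "b \<in> {b. l0_norm b \<le> s}"
        using card_mono[OF _ S(2)] by (simp add: l0_norm_def)
    qed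
    then show ?thesis by blast
  qed
  have "closed ((*v) X ` {b. l0_norm b \<le> s})"
    unfolding eq by (rule closed_UN) (simp_all add: closed_subspace sub)
  moreover have "(*v) X ` {b. l0_norm b \<le> s} \<noteq> {}"
    by (auto simp: l0_norm_def intro!: exI[of _ 0])
  ultimately obtain z where z: "z \<in> (*v) X ` {b. l0_norm b \<le> s}"
    "\<And>y. y \<in> (*v) X ` {b. l0_norm b \<le> s} \<Longrightarrow> dist f z \<le> dist f y"
    using distance_attains_inf by metis
  then obtain \<beta> where \<beta>: "l0_norm \<beta> \<le> s" "z = X *v \<beta>" by auto
  have le: "(emp_norm (X *v \<beta> - f))\<^sup>2 \<le> (emp_norm (X *v b - f))\<^sup>2" if "l0_norm b \<le> s" for b
    using z(2)[of "X *v b"] that \<beta>(2)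
    by (auto simp: emp_norm_eq dist_norm norm_minus_commute intro!: power_mono divide_right_mono)
  have "(INF b\<in>{b. l0_norm b \<le> s}. (emp_norm (X *v b - f))\<^sup>2) = (emp_norm (X *v \<beta> - f))\<^sup>2"
    using \<beta>(1) le by (intro cInf_eq_minimum) auto
  with \<beta>(1) that show thesis by blast
qed

section \<open>The noise functional of the Lasso\<close>

context gaussian_vector
begin

text \<open>The supremum \<open>G\<close> from the introduction, for a fixed sparse vector \<open>\<beta>\<close>. The key step is the bound for a vector \<open>z\<close> that is
orthogonal to the columns in the support and has small inner products with the others. For \<open>z = 0\<close> it bounds the
penalty difference alone, which makes the supremum finite and settles the directions with \<open>X u = 0\<close>.\<close>

theorem lasso_noise_functional_bound:
  fixes X :: "real ^ 'p ^ 'n"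
  assumes X: "\<And>j. emp_norm (X *v axis j 1) \<le> 1"
    and p: "2 \<le> CARD('p)" and s: "1 \<le> s" "s \<le> CARD('p)" and \<epsilon>: "0 < \<epsilon>"
    and lam: "lam = (1 + \<epsilon>) * \<sigma> * sqrt (2 * ln (real CARD('p)) / real CARD('n))"
    and \<beta>: "l0_norm \<beta> \<le> s" and \<kappa>: "0 < RE_const X s (1 + 1 / \<epsilon>)"
    and \<delta>: "0 < \<delta>" "\<delta> < 1"
  obtains G where
    "\<And>z u. z \<bullet> (X *v u) + real CARD('n) * lam * (l1_norm \<beta> - l1_norm (\<beta> + u)) \<le> G z * norm (X *v u)"
    and "1-lipschitz_on UNIV G"
    and "1 - \<delta> \<le> prob {\<omega> \<in> space M. G (\<xi> \<omega>) \<le>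
      \<sigma> * ((1 + \<epsilon>) * sqrt (2 * real s * ln (real CARD('p))) / RE_const X s (1 + 1 / \<epsilon>)
        + sqrt (real s) + sqrt (2 * ln (1 / \<delta>)) + 2.8)}"
proof -
  let ?n = "real CARD('n)" and ?p = "real CARD('p)" and ?\<kappa> = "RE_const X s (1 + 1 / \<epsilon>)"
  define S where "S = {j. \<beta> $ j \<noteq> 0}"
  have S: "card S \<le> s" using \<beta> by (simp add: S_def l0_norm_def)
  define pen where "pen u = ?n * lam * (l1_norm \<beta> - l1_norm (\<beta> + u))" for u
  define K where "K = \<sigma> * ((1 + \<epsilon>) * sqrt (2 * real s * ln ?p) / ?\<kappa>)"
  have lnp: "0 < ln ?p" using p by simp
  have lam_pos: "0 < lam" using lam \<epsilon> sigma_pos lnp by simp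
  have n_lam: "?n * lam = sqrt ?n * ((1 + \<epsilon>) * \<sigma> * sqrt (2 * ln ?p))"
  proof -
    have "?n * lam = (?n / sqrt ?n) * ((1 + \<epsilon>) * \<sigma> * sqrt (2 * ln ?p))"
      unfolding lam real_sqrt_divide by simp
    then show ?thesis by (simp only: real_div_sqrt of_nat_0_le_iff)
  qed
  have K: "0 \<le> K" using \<kappa> \<epsilon> sigma_pos lnp by (simp add: K_def)
  define x where "x j = X *v axis j 1" for j
  have x: "norm (x j) \<le> sqrt ?n" for j
    using X[of j] by (simp add: emp_norm_eq x_def)
  have Xu: "X *v u = (\<Sum>j\<in>UNIV. u $ j *\<^sub>R x j)" for u
    unfolding x_def matrix_vector_mult_basis by (simp add: matrix_mult_sum scalar_mult_eq_scaleR)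
  obtain B where B: "orthonormal B" "card B = dim (x ` S)" "span B = span (x ` S)"
    by (rule orthonormal_basis_exists)
  let ?P = "proj B"
  have cardB: "card B \<le> s"
  proof -
    have "dim (x ` S) \<le> card (x ` S)" by (rule dim_le_card') simp
    also have "\<dots> \<le> card S" by (rule card_image_le) simp
    finally show ?thesis using B(2) S by simp
  qed
  have bound: "z \<bullet> (X *v u) + pen u \<le> K * norm (X *v u)"
    if orth: "\<And>j. j \<in> S \<Longrightarrow> x j \<bullet> z = 0" and small: "\<And>j. \<bar>x j \<bullet> z\<bar> \<le> ?n * lam / (1 + \<epsilon>)" for z u
  proof -
    let ?a = "\<Sum>j\<in>S. \<bar>u $ j\<bar>" and ?b = "\<Sum>j\<in>-S. \<bar>u $ j\<bar>"
    have "z \<bullet> (X *v u) = (\<Sum>j\<in>UNIV. u $ j * (x j \<bullet> z))"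
      by (simp add: Xu inner_sum_right inner_commute)
    also have "\<dots> = (\<Sum>j\<in>-S. u $ j * (x j \<bullet> z))"
      using orth by (intro sum.mono_neutral_right) auto
    also have "\<dots> \<le> (\<Sum>j\<in>-S. \<bar>u $ j\<bar> * (?n * lam / (1 + \<epsilon>)))"
    proof (rule sum_mono)
      fix j
      have "u $ j * (x j \<bullet> z) \<le> \<bar>u $ j\<bar> * \<bar>x j \<bullet> z\<bar>"
        by (metis abs_ge_self abs_mult)
      also have "\<dots> \<le> \<bar>u $ j\<bar> * (?n * lam / (1 + \<epsilon>))"
        by (intro mult_left_mono small) auto
      finally show "u $ j * (x j \<bullet> z) \<le> \<bar>u $ j\<bar> * (?n * lam / (1 + \<epsilon>))" .
    qed
    also have "\<dots> = ?n * lam * (?b / (1 + \<epsilon>))"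
      by (simp only: sum_distrib_right[symmetric]) simp
    finally have "z \<bullet> (X *v u) \<le> ?n * lam * (?b / (1 + \<epsilon>))" .
    moreover have "pen u \<le> ?n * lam * (?a - ?b)"
      unfolding pen_def using lam_pos by (intro mult_left_mono l1_norm_diff_le) (auto simp: S_def)
    ultimately have "z \<bullet> (X *v u) + pen u \<le> ?n * lam * (?b / (1 + \<epsilon>) + (?a - ?b))"
      by (simp add: distrib_left)
    also have "?b / (1 + \<epsilon>) + (?a - ?b) = ?a - \<epsilon> / (1 + \<epsilon>) * ?b"
    proof -
      have "\<epsilon> / (1 + \<epsilon>) = 1 - 1 / (1 + \<epsilon>)" using \<epsilon> by (simp add: field_simps)
      then show ?thesis by (simp only: left_diff_distrib) simp
    qed
    also have "?n * lam * (?a - \<epsilon> / (1 + \<epsilon>) * ?b) \<le> ?n * lam * (sqrt (real s) * emp_norm (X *v u) / ?\<kappa>)"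
      using lam_pos S s \<epsilon> \<kappa> by (intro mult_left_mono restricted_eigenvalue_penalty_bound) auto
    also have "\<dots> = K * norm (X *v u)"
    proof -
      have "sqrt (2 * real s * ln ?p) = sqrt (2 * ln ?p) * sqrt (real s)"
        by (simp add: real_sqrt_mult)
      then show ?thesis
        unfolding n_lam K_def emp_norm_eq by simp
    qed
    finally show ?thesis .
  qed
  have pen_le: "pen u \<le> K * norm (X *v u)" for u
    using bound[of 0 u] lam_pos \<epsilon> by simp
  define U where "U = {u. X *v u \<noteq> 0}"
  have U_ne: "U \<noteq> {}"
  proof -
    fix j :: 'p
    have "?\<kappa> * norm (axis j 1 :: real ^ 'p) \<le> emp_norm (X *v axis j 1)"
      using s \<epsilon> by (intro RE_const_le axis_in_RE_cone) (auto simp: axis_eq_0_iff)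
    then have "X *v axis j 1 \<noteq> 0"
      using \<kappa> by (auto simp: emp_norm_eq)
    then show ?thesis by (auto simp: U_def)
  qed
  define a where "a u = (X *v u) /\<^sub>R norm (X *v u)" for u
  define c where "c u = pen u / norm (X *v u)" for u
  have a: "norm (a u) \<le> 1" if "u \<in> U" for u
    using that by (simp add: a_def U_def)
  have c: "c u \<le> K" if "u \<in> U" for u
    using that pen_le[of u] by (simp add: c_def U_def pos_divide_le_eq)
  define G where "G z = (SUP u\<in>U. a u \<bullet> z + c u)" for z
  have lip: "1-lipschitz_on UNIV G"
    unfolding G_def using lipschitz_on_SUP_affine[OF U_ne a c] by simp
  have [measurable]: "G \<in> borel_measurable borel"
    by (intro borel_measurable_continuous_onI lipschitz_on_continuous_on[OF lip])
  have scaled: "z \<bullet> (X *v u) + pen u = (a u \<bullet> z + c u) * norm (X *v u)" if "u \<in> U" for z u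
    using that by (simp add: a_def c_def U_def inner_commute field_simps)
  have G_le: "G z \<le> K" if "\<And>j. j \<in> S \<Longrightarrow> x j \<bullet> z = 0" "\<And>j. \<bar>x j \<bullet> z\<bar> \<le> ?n * lam / (1 + \<epsilon>)" for z
    unfolding G_def
  proof (rule cSUP_least[OF U_ne])
    fix u assume u: "u \<in> U"
    have "(a u \<bullet> z + c u) * norm (X *v u) \<le> K * norm (X *v u)"
      using bound[of z u] that scaled[OF u, of z] by simp
    then show "a u \<bullet> z + c u \<le> K"
      using u by (simp add: U_def)
  qed
  have le_G: "z \<bullet> (X *v u) + pen u \<le> G z * norm (X *v u)" for z u
  proof (cases "u \<in> U")
    case True
    have "bdd_above ((\<lambda>u. a u \<bullet> z + c u) ` U)"
    proof (rule bdd_aboveI2)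
      fix u assume u: "u \<in> U"
      show "a u \<bullet> z + c u \<le> norm z + K"
        using norm_cauchy_schwarz[of "a u" z] mult_right_mono[OF a[OF u], of "norm z"] c[OF u] by simp
    qed
    then have "a u \<bullet> z + c u \<le> G z"
      unfolding G_def by (rule cSUP_upper[OF True])
    then show ?thesis
      unfolding scaled[OF True] by (rule mult_right_mono) simp
  next
    case False
    then show ?thesis using pen_le[of u] by (simp add: U_def)
  qed
  have "0.29 \<le> prob {\<omega> \<in> space M. \<forall>j\<in>UNIV. \<bar>(x j - ?P (x j)) \<bullet> \<xi> \<omega>\<bar> \<le> sqrt ?n * \<sigma> * sqrt (2 * ln ?p)}"
  proof (rule maximal_inequality)
    show "norm (x j - ?P (x j)) \<le> sqrt ?n" for j
      using norm_residual_le[OF B(1), of "x j"] x[of j] by simp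
  qed (use p in auto)
  also have "\<dots> \<le> prob {\<omega> \<in> space M. G (\<xi> \<omega> - ?P (\<xi> \<omega>)) \<le> K}"
  proof (rule finite_measure_mono)
    have nl: "?n * lam / (1 + \<epsilon>) = sqrt ?n * \<sigma> * sqrt (2 * ln ?p)"
      unfolding n_lam using \<epsilon> by simp
    show "{\<omega> \<in> space M. \<forall>j\<in>UNIV. \<bar>(x j - ?P (x j)) \<bullet> \<xi> \<omega>\<bar> \<le> sqrt ?n * \<sigma> * sqrt (2 * ln ?p)}
        \<subseteq> {\<omega> \<in> space M. G (\<xi> \<omega> - ?P (\<xi> \<omega>)) \<le> K}"
    proof safe
      fix \<omega> assume *: "\<forall>j\<in>UNIV. \<bar>(x j - ?P (x j)) \<bullet> \<xi> \<omega>\<bar> \<le> sqrt ?n * \<sigma> * sqrt (2 * ln ?p)"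
      show "G (\<xi> \<omega> - ?P (\<xi> \<omega>)) \<le> K"
      proof (rule G_le)
        show "x j \<bullet> (\<xi> \<omega> - ?P (\<xi> \<omega>)) = 0" if "j \<in> S" for j
          using that B(3) by (intro inner_residual_eq_0[OF B(1)]) (auto intro: span_base)
        show "\<bar>x j \<bullet> (\<xi> \<omega> - ?P (\<xi> \<omega>))\<bar> \<le> ?n * lam / (1 + \<epsilon>)" for j
          unfolding inner_residual_adjoint nl using * by simp
      qed
    qed
    show "{\<omega> \<in> space M. G (\<xi> \<omega> - ?P (\<xi> \<omega>)) \<le> K} \<in> events"
      by measurable
  qed
  finally have "1 - \<delta> \<le> prob {\<omega> \<in> space M. G (\<xi> \<omega>) \<le> K + \<sigma> * (sqrt (real (card B)) + sqrt (2 * ln (1 / \<delta>)) + 2.8)}"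
    by (intro lipschitz_deviation_modulo_projection lip B(1) K \<delta>)
  also have "\<dots> \<le> prob {\<omega> \<in> space M. G (\<xi> \<omega>) \<le>
      \<sigma> * ((1 + \<epsilon>) * sqrt (2 * real s * ln ?p) / ?\<kappa> + sqrt (real s) + sqrt (2 * ln (1 / \<delta>)) + 2.8)}"
  proof (rule finite_measure_mono)
    have "\<sigma> * sqrt (real (card B)) \<le> \<sigma> * sqrt (real s)"
      using cardB sigma_pos by simp
    then have "K + \<sigma> * (sqrt (real (card B)) + sqrt (2 * ln (1 / \<delta>)) + 2.8) \<le>
        \<sigma> * ((1 + \<epsilon>) * sqrt (2 * real s * ln ?p) / ?\<kappa> + sqrt (real s) + sqrt (2 * ln (1 / \<delta>)) + 2.8)"
      unfolding K_def distrib_left by linarith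
    then show "{\<omega> \<in> space M. G (\<xi> \<omega>) \<le> K + \<sigma> * (sqrt (real (card B)) + sqrt (2 * ln (1 / \<delta>)) + 2.8)} \<subseteq>
        {\<omega> \<in> space M. G (\<xi> \<omega>) \<le> \<sigma> * ((1 + \<epsilon>) * sqrt (2 * real s * ln ?p) / ?\<kappa> + sqrt (real s) + sqrt (2 * ln (1 / \<delta>)) + 2.8)}"
      by auto
  qed measurable
  finally show thesis
    using that[OF _ lip] le_G unfolding pen_def by blast
qed

end

section \<open>The oracle inequality\<close>

theorem proposition3p2:
  fixes X :: "real ^ 'p ^ 'n" and f :: "real ^ 'n"
    and M :: "'a measure" and \<xi> :: "'a \<Rightarrow> real ^ 'n" and \<beta>hat :: "'a \<Rightarrow> real ^ 'p"
    and \<sigma> \<epsilon> c0 lam \<delta> :: real and s :: nat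
  assumes "\<sigma> > 0"
    and "\<And>j. emp_norm (X *v axis j 1) \<le> 1"
    and "prob_space M"
    and "distributed M lborel \<xi> (\<lambda>x. ennreal (iso_normal_density \<sigma> x))"
    and "CARD('p) \<ge> 2"
    and "1 \<le> s" and "s \<le> CARD('p)"
    and "\<epsilon> > 0"
    and "c0 = 1 + 1 / \<epsilon>"
    and "lam = (1 + \<epsilon>) * \<sigma> * sqrt (2 * ln (real CARD('p)) / real CARD('n))"
    and "\<And>\<omega>. \<omega> \<in> space M \<Longrightarrow> is_lasso X (f + \<xi> \<omega>) lam (\<beta>hat \<omega>)"
    and "0 < \<delta>" and "\<delta> < 1"
  shows "measure M {\<omega> \<in> space M.
      ereal ((emp_norm (X *v \<beta>hat \<omega> - f))\<^sup>2) \<le>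
        (if RE_const X s c0 = 0 then \<infinity>
         else ereal ((INF \<beta>\<in>{\<beta>. l0_norm \<beta> \<le> s}. (emp_norm (X *v \<beta> - f))\<^sup>2) +
           \<sigma>\<^sup>2 / real CARD('n) *
             ((1 + \<epsilon>) * sqrt (2 * real s * ln (real CARD('p))) / RE_const X s c0
               + sqrt (real s) + sqrt (2 * ln (1 / \<delta>)) + 2.8)\<^sup>2))} \<ge> 1 - \<delta>"
proof -
  let ?n = "real CARD('n)" and ?\<kappa> = "RE_const X s c0"
  define T where "T = (1 + \<epsilon>) * sqrt (2 * real s * ln (real CARD('p))) / ?\<kappa>
    + sqrt (real s) + sqrt (2 * ln (1 / \<delta>)) + 2.8"
  define v where "v = (INF \<beta>\<in>{\<beta>. l0_norm \<beta> \<le> s}. (emp_norm (X *v \<beta> - f))\<^sup>2)"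
  interpret prob_space M by fact
  interpret gaussian_vector M \<xi> \<sigma>
    using assms by unfold_locales auto
  have lam: "0 \<le> lam"
    using assms by auto
  show ?thesis
  proof (cases "?\<kappa> = 0")
    case True
    then show ?thesis
      using prob_space \<open>0 < \<delta>\<close> by simp
  next
    case False
    have "0 \<le> ?\<kappa>"
      using assms by (intro RE_const_nonneg) auto
    with False have \<kappa>: "0 < ?\<kappa>" by simp
    have T: "0 \<le> T"
      unfolding T_def using assms \<kappa> by (intro add_nonneg_nonneg divide_nonneg_nonneg mult_nonneg_nonneg) auto
    obtain \<beta> where \<beta>: "l0_norm \<beta> \<le> s" "v = (emp_norm (X *v \<beta> - f))\<^sup>2"
      using sparse_least_squares_attained[of s X f] unfolding v_def by metis
    obtain G where G: "\<And>z u. z \<bullet> (X *v u) + ?n * lam * (l1_norm \<beta> - l1_norm (\<beta> + u)) \<le> G z * norm (X *v u)"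
      and lip: "1-lipschitz_on UNIV G"
      and prob_G: "1 - \<delta> \<le> prob {\<omega> \<in> space M. G (\<xi> \<omega>) \<le> \<sigma> * T}"
      using lasso_noise_functional_bound[of X s \<epsilon> lam \<beta> \<delta>] assms \<beta>(1) \<kappa> unfolding T_def by auto
    have [measurable]: "(\<lambda>\<omega>. X *v \<beta>hat \<omega>) \<in> borel_measurable M"
      using assms by (intro lasso_fit_measurable[OF measurable_vec lam]) auto
    have "1 - \<delta> \<le> prob {\<omega> \<in> space M. (emp_norm (X *v \<beta>hat \<omega> - f))\<^sup>2 \<le> v + \<sigma>\<^sup>2 / ?n * T\<^sup>2}"
    proof (rule order_trans[OF prob_G], rule finite_measure_mono)
      show "{\<omega> \<in> space M. (emp_norm (X *v \<beta>hat \<omega> - f))\<^sup>2 \<le> v + \<sigma>\<^sup>2 / ?n * T\<^sup>2} \<in> events"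
        unfolding emp_norm_eq by measurable
      show "{\<omega> \<in> space M. G (\<xi> \<omega>) \<le> \<sigma> * T} \<subseteq>
          {\<omega> \<in> space M. (emp_norm (X *v \<beta>hat \<omega> - f))\<^sup>2 \<le> v + \<sigma>\<^sup>2 / ?n * T\<^sup>2}"
      proof safe
        fix \<omega> assume \<omega>: "\<omega> \<in> space M" and le: "G (\<xi> \<omega>) \<le> \<sigma> * T"
        define m where "m = norm (X *v (\<beta>hat \<omega> - \<beta>))"
        have "G (\<xi> \<omega>) * m \<le> \<sigma> * T * m"
          using le by (intro mult_right_mono) (simp_all add: m_def)
        define q where "q = \<xi> \<omega> \<bullet> (X *v (\<beta>hat \<omega> - \<beta>)) + ?n * lam * (l1_norm \<beta> - l1_norm (\<beta>hat \<omega>))"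
        have "q \<le> \<sigma> * T * m"
          using G[of "\<xi> \<omega>" "\<beta>hat \<omega> - \<beta>"] \<open>G (\<xi> \<omega>) * m \<le> \<sigma> * T * m\<close> by (simp add: m_def q_def)
        moreover have "2 * (\<sigma> * T * m) - m\<^sup>2 \<le> (\<sigma> * T)\<^sup>2"
          using zero_le_power2[of "\<sigma> * T - m"] by (simp add: power2_diff)
        moreover have "(norm (X *v \<beta>hat \<omega> - f))\<^sup>2 \<le> (norm (X *v \<beta> - f))\<^sup>2 + 2 * q - m\<^sup>2"
          using lasso_basic_inequality[OF assms(11)[OF \<omega>] lam, of \<beta>] by (simp only: q_def m_def)
        ultimately have "(norm (X *v \<beta>hat \<omega> - f))\<^sup>2 \<le> (norm (X *v \<beta> - f))\<^sup>2 + (\<sigma> * T)\<^sup>2"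
          by linarith
        then have "(norm (X *v \<beta>hat \<omega> - f))\<^sup>2 / ?n \<le> ((norm (X *v \<beta> - f))\<^sup>2 + (\<sigma> * T)\<^sup>2) / ?n"
          by (rule divide_right_mono) simp
        then show "(emp_norm (X *v \<beta>hat \<omega> - f))\<^sup>2 \<le> v + \<sigma>\<^sup>2 / ?n * T\<^sup>2"
          by (simp add: \<beta>(2) emp_norm_eq power_divide power_mult_distrib add_divide_distrib)
      qed
    qed
    then show ?thesis
      using False unfolding T_def[symmetric] v_def[symmetric] by simp
  qed
qed

end
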